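(* Let $N\ge 2$, $k\in\{1,\dots,N\}$, and let $s\in(0,\tfrac12)$ if $k=1$, $s\in(0,1)$ if $k\ge 2$. Let $u\in LSC(\mathbb{R}^N_+)\cap\mathcal S$ be a nonnegative viscosity supersolution of $$\mathcal I_k^+u(x)+u^p(x)=0\ \text{ in }\mathbb{R}^N_+,\qquad u=0\ \text{ in }\mathbb{R}^N\setminus\mathbb{R}^N_+ .$$ If $0<p<1+\frac{2s}{\bar\gamma+1}$, then $u(x)\equiv 0$ in $\mathbb{R}^N_+$.
   Context: $\mathbb{R}^N_+=\{x=(x',x_N)\in\mathbb{R}^{N-1}\times\mathbb{R}: x_N>0\}$. For a unit vector $\xi\in\mathbb{R}^N$, $$\mathcal I_\xi u(x)=C_s\int_0^{+\infty}\frac{u(x+\tau\xi)+u(x-\tau\xi)-2u(x)}{\tau^{1+2s}}\,d\tau,$$ where $C_s>0$ is a normalizing constant depending only on $s$ (chosen so that $\mathcal I_\xi u(x)\to\langle D^2u(x)\xi,\xi\rangle$ as $s\to1^-$). $\mathcal V_k$ is the set of $k$-element orthonormal families $\{\xi_1,\dots,\xi_k\}$ in $\mathbb{R}^N$, and $\mathcal I_k^+u(x)=\sup_{\{\xi_i\}\in\mathcal V_k}\sum_{i=1}^k\mathcal I_{\xi_i}u(x)$. $\mathcal S$ is the space of functions $u:\mathbb{R}^N\to\mathbb{R}$ such that (i) for every $x\in\mathbb{R}^N_+$ and unit vector $\xi$, the map $\tau\in\mathbb{R}\mapsto u(x+\tau\xi)$ is measurable; (ii) there are $\alpha\in[0,2s)$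 and $C>0$ with $|u(x)|\le C(1+|x|)^\alpha$ for all $x\in\mathbb{R}^N$. $LSC(\mathbb{R}^N_+)$ means lower semicontinuous on $\mathbb{R}^N_+$. Viscosity supersolution: $u\in\mathcal S\cap LSC(\mathbb{R}^N_+)$ is a viscosity supersolution of $\mathcal I u+f(x,u)=0$ in $\mathbb{R}^N_+$ if for every $x_0\in\mathbb{R}^N_+$, $r>0$ with $B_r(x_0)\subseteq\mathbb{R}^N_+$ and $\varphi\in C^2(\overline{B_r(x_0)})$ with $\varphi(x_0)=u(x_0)$ and $\varphi\le u$ in $B_r(x_0)$, the function $\psi$ equal to $\varphi$ in $B_r(x_0)$ and to $u$ in $\mathbb{R}^N\setminus B_r(x_0)$ satisfies $\mathcal I\psi(x_0)+f(x_0,u(x_0))\le 0$. It is a supersolution of the problem with condition $u=0$ in $\mathbb{R}^N\setminus\mathbb{R}^N_+$ if this holds (with $f(x,u)=u^p$) and $u\ge0$ in $\mathbb{R}^N\setminus\mathbb{R}^N_+$. "Nonnegative" means $u\geq 0$ in $\mathbb{R}^N$. The number $\bar\gamma=\bar\gamma(k,s)\in(0,1)$ is the unique exponent in $(0,1)$ for which $w_\gamma(x)=|x|^{-\gamma}$ satisfies $\mathcal I_k^+w_\gamma=0$ in $\mathbb{R}^N\setminus\{0\}$ (it exists exactly when $k=1$, $s\in(0,\frac12)$, or $k\ge2$, $s\in(0,1)$). Equivalently, it is the unique zero in $(0,1)$ of $c_k(\gamma)=\hat c(\gamma)+(k-1)c^\perp(\gamma)$, where $$\hat c(\gamma)=C_s\,\mathrm{P.V.}\!\int_{-\infty}^{+\infty}\frac{|1+\tau|^{-\gamma}-1}{|\tau|^{1+2s}}d\tau,\qquad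 c^\perp(\gamma)=2C_s\int_0^{+\infty}\frac{(1+\tau^2)^{-\gamma/2}-1}{\tau^{1+2s}}d\tau .$$ *)

theory Defs
  imports "HOL-Analysis.Analysis"
begin

(* R^N is any Euclidean space 'a; the half-space uses R^N = R^(N-1) x R in the product type
   'b \<times> real, whose norm and inner product are the Euclidean ones. *)

definition half_space :: "('b::euclidean_space \<times> real) set" where
  "half_space = {x. 0 < snd x}"

(* The normalizing constant is a function C of s alone.
   The integral is taken over lebesgue rather than lborel, since functions of the class S below
   are only assumed to be measurable along lines. *)

definition frac_dir ::
  "(real \<Rightarrow> real) \<Rightarrow> real \<Rightarrow> 'a::euclidean_space \<Rightarrow> ('a \<Rightarrow> real) \<Rightarrow> 'a \<Rightarrow> real" where
  "frac_dir C s \<xi> u x =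
     C s * set_lebesgue_integral lebesgue {0<..}
       (\<lambda>\<tau>. (u (x + \<tau> *\<^sub>R \<xi>) + u (x - \<tau> *\<^sub>R \<xi>) - 2 * u x) / \<tau> powr (1 + 2 * s))"

definition orthonormal_families :: "nat \<Rightarrow> 'a::euclidean_space set set" where
  "orthonormal_families k =
     {B. finite B \<and> card B = k \<and> pairwise orthogonal B \<and> (\<forall>\<xi>\<in>B. norm \<xi> = 1)}"

(* The supremum is a real one: for the functions to which the operator is applied (C^2 near x,
   with controlled integrals along the lines through x) the sums are bounded uniformly in B. *)

definition frac_plus ::
  "(real \<Rightarrow> real) \<Rightarrow> real \<Rightarrow> nat \<Rightarrow> ('a::euclidean_space \<Rightarrow> real) \<Rightarrow> 'a \<Rightarrow> real" where
  "frac_plus C s k u x = (SUP B\<in>orthonormal_families k. \<Sum>\<xi>\<in>B. frac_dir C s \<xi> u x)"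

(* On a closed ball, derivatives within the ball amount to C^2 up to the boundary. *)

definition C2_derivs_on ::
  "'a::euclidean_space set \<Rightarrow> ('a \<Rightarrow> real) \<Rightarrow> ('a \<Rightarrow> 'a \<Rightarrow>\<^sub>L real) \<Rightarrow> ('a \<Rightarrow> 'a \<Rightarrow>\<^sub>L 'a \<Rightarrow>\<^sub>L real) \<Rightarrow> bool"
  where
  "C2_derivs_on S f D1 D2 \<longleftrightarrow>
     (\<forall>x\<in>S. (f has_derivative blinfun_apply (D1 x)) (at x within S)) \<and>
     (\<forall>x\<in>S. (D1 has_derivative blinfun_apply (D2 x)) (at x within S)) \<and>
     continuous_on S D2"

definition C2_on :: "'a::euclidean_space set \<Rightarrow> ('a \<Rightarrow> real) \<Rightarrow> bool" where
  "C2_on S f \<longleftrightarrow> (\<exists>D1 D2. C2_derivs_on S f D1 D2)"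

(* Normalization: I_xi u (x) tends to <D^2 u(x) xi, xi> as s tends to 1 from the left, for bounded
   u of class C^2 (boundedness makes the integrals converge for every s in (0,1)).
   It holds e.g. for C s = 2 * (1 - s) and for the constant of the one-dimensional
   fractional Laplacian. *)

definition normalizing_constant :: "'a::euclidean_space itself \<Rightarrow> (real \<Rightarrow> real) \<Rightarrow> bool" where
  "normalizing_constant _ C \<longleftrightarrow>
     (\<forall>s\<in>{0<..<1}. 0 < C s) \<and>
     (\<forall>(u :: 'a \<Rightarrow> real) D1 D2 x \<xi>.
        C2_derivs_on UNIV u D1 D2 \<and> bounded (range u) \<and> norm \<xi> = 1 \<longrightarrow>
        ((\<lambda>s. frac_dir C s \<xi> u x) \<longlongrightarrow> D2 x \<xi> \<xi>) (at_left 1))"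

(* The value |0| powr (- g) = 0 at the origin is irrelevant: it affects the integrand of frac_dir
   at a point x \<noteq> 0 in at most one value of \<tau>. *)

definition gamma_bar ::
  "'a::euclidean_space itself \<Rightarrow> (real \<Rightarrow> real) \<Rightarrow> real \<Rightarrow> nat \<Rightarrow> real" where
  "gamma_bar _ C s k =
     (THE g. 0 < g \<and> g < 1 \<and>
        (\<forall>x::'a. x \<noteq> 0 \<longrightarrow> frac_plus C s k (\<lambda>y. norm y powr (- g)) x = 0))"

definition lsc_on :: "'a::topological_space set \<Rightarrow> ('a \<Rightarrow> real) \<Rightarrow> bool" where
  "lsc_on S u \<longleftrightarrow> (\<forall>x\<in>S. \<forall>a < u x. \<forall>\<^sub>F y in at x within S. a < u y)"

definition class_S :: "real \<Rightarrow> ('b::euclidean_space \<times> real \<Rightarrow> real) set" where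
  "class_S s =
     {u. (\<forall>x\<in>half_space. \<forall>\<xi>. norm \<xi> = 1 \<longrightarrow>
            (\<lambda>\<tau>. u (x + \<tau> *\<^sub>R \<xi>)) \<in> borel_measurable lebesgue) \<and>
         (\<exists>\<alpha> C. 0 \<le> \<alpha> \<and> \<alpha> < 2 * s \<and> 0 < C \<and> (\<forall>x. \<bar>u x\<bar> \<le> C * (1 + norm x) powr \<alpha>))}"

definition viscosity_supersolution ::
  "(('b::euclidean_space \<times> real \<Rightarrow> real) \<Rightarrow> 'b \<times> real \<Rightarrow> real) \<Rightarrow> real \<Rightarrow>
   ('b \<times> real \<Rightarrow> real \<Rightarrow> real) \<Rightarrow> ('b \<times> real \<Rightarrow> real) \<Rightarrow> bool" where
  "viscosity_supersolution I s f u \<longleftrightarrow>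
     u \<in> class_S s \<and> lsc_on half_space u \<and>
     (\<forall>x0\<in>half_space. \<forall>r>0. \<forall>\<phi>.
        ball x0 r \<subseteq> half_space \<and> C2_on (cball x0 r) \<phi> \<and>
        \<phi> x0 = u x0 \<and> (\<forall>x\<in>ball x0 r. \<phi> x \<le> u x) \<longrightarrow>
        I (\<lambda>x. if x \<in> ball x0 r then \<phi> x else u x) x0 + f x0 (u x0) \<le> 0)"

definition dirichlet_supersolution ::
  "(('b::euclidean_space \<times> real \<Rightarrow> real) \<Rightarrow> 'b \<times> real \<Rightarrow> real) \<Rightarrow> real \<Rightarrow>
   ('b \<times> real \<Rightarrow> real \<Rightarrow> real) \<Rightarrow> ('b \<times> real \<Rightarrow> real) \<Rightarrow> bool" where
  "dirichlet_supersolution I s f u \<longleftrightarrow>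
     viscosity_supersolution I s f u \<and> (\<forall>x. x \<notin> half_space \<longrightarrow> 0 \<le> u x)"

end

theory Submission
  imports Defs "HOL-Real_Asymp.Real_Asymp"
begin

text \<open>The supremum over frames is very favourable to propagation of positivity: if \<open>u > 0\<close> on a
  ball, then from any point at distance of order \<open>R\<close> a line can be aimed at that ball, and it
  contributes at least a multiple of \<open>R powr (- 1 - 2 * s)\<close> to the operator, while a bump of height \<open>h\<close>
  and width \<open>R\<close> costs only a multiple of \<open>h * R powr (- 2 * s)\<close>.  Touching \<open>u\<close> from below by such bumps
  therefore gives \<open>u \<ge> c / R\<close> at distance \<open>R\<close>.  On the other hand, testing with a bump of the
  size of \<open>M R\<close>, the minimum of \<open>u\<close> over a ball of radius \<open>R\<close>, gives
  \<open>M R powr p \<le> b * M R * R powr (- 2 * s)\<close>.  The two are incompatible as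
  soon as \<open>p < 1 + 2 * s\<close> (for \<open>p < 1\<close> the growth condition replaces the lower bound).

  It remains to see that \<open>gamma_bar > 0\<close>, which amounts to existence and uniqueness of the exponent.
  By convexity in the squared cosine of the angle with \<open>x\<close>, the supremum for \<open>norm x powr (- g)\<close> is
  attained at frames containing the radial direction, so the exponents are the zeros of a
  coefficient that is convex in \<open>g\<close>, vanishes at \<open>0\<close> and tends to infinity at \<open>1\<close>.  Its
  derivative at \<open>0\<close> is minus a logarithmic integral, whose sign follows by comparing the kernel
  with the one for which the integral is zero by an explicit antiderivative.\<close>

section \<open>Power kernels, quadratic test functions and semicontinuity\<close>

text \<open>The bump that tests the equation at scale R touches \<open>u\<close> at a point known
  only to lie in a ball larger than the one over which the minimum M R is taken. Propagation is
  therefore used twice: from the fixed ball around \<open>y\<close> to scale R, where a source of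
  fixed width costs a factor 1 / R, and from scale R to scale R, where source and bump are of
  comparable size and only a constant is lost. The second use acts as a Harnack inequality and
  carries the minimum over to the touching point.

  A non-integrable function has integral 0 by default and an unbounded set has an unspecified
  supremum, so the operator can be estimated only after integrability along every line and a uniform
  upper bound are known. Both come from the quadratic shape of the bump near the touching point and
  from the growth exponent \<alpha> < 2 * s.

  \<open>gamma_bar\<close> is a definite description, hence uninformative before unique existence is
  known. The assumption on s enters there as 2 * s < m with m = min k 2: the logarithmic integral
  vanishes when 2 * s = m and is positive below.\<close>

lemma set_integrable_powr_tail:
  fixes a e :: real
  assumes "0 < a" "e < -1"
  shows "set_integrable lebesgue {a..} (\<lambda>t. t powr e)"
    and "(LINT t:{a..}|lebesgue. t powr e) = a powr (e + 1) / (- e - 1)"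
proof -
  have h: "((\<lambda>t. t powr e) has_integral - (a powr (e + 1)) / (e + 1)) {a..}"
    by (rule has_integral_powr_to_inf) (use assms in auto)
  show i: "set_integrable lebesgue {a..} (\<lambda>t. t powr e)"
    by (rule nonnegative_absolutely_integrable_1) (use h in auto)
  show "(LINT t:{a..}|lebesgue. t powr e) = a powr (e + 1) / (- e - 1)"
    using set_lebesgue_integral_eq_integral(2)[OF i] integral_unique[OF h] assms
    by (simp add: field_simps)
qed

lemma set_integrable_powr_0:
  fixes c e :: real
  assumes "0 < c" "-1 < e"
  shows "set_integrable lebesgue {0<..<c} (\<lambda>t. t powr e)"
    and "(LINT t:{0<..<c}|lebesgue. t powr e) = c powr (e + 1) / (e + 1)"
proof -
  have "((\<lambda>t. t powr e) has_integral c powr (e + 1) / (e + 1)) {0..c}"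
    by (rule has_integral_powr_from_0) (use assms in auto)
  then have h: "((\<lambda>t. t powr e) has_integral c powr (e + 1) / (e + 1)) {0<..<c}"
    by (simp add: has_integral_Icc_iff_Ioo)
  show i: "set_integrable lebesgue {0<..<c} (\<lambda>t. t powr e)"
    by (rule nonnegative_absolutely_integrable_1) (use h in auto)
  show "(LINT t:{0<..<c}|lebesgue. t powr e) = c powr (e + 1) / (e + 1)"
    using set_lebesgue_integral_eq_integral(2)[OF i] integral_unique[OF h] by simp
qed

lemma set_integral_piecewise:
  fixes f g :: "real \<Rightarrow> real" and r :: real
  assumes r: "0 < r"
    and f: "set_integrable lebesgue {0<..<r} f" and g: "set_integrable lebesgue {r..} g"
  shows "set_integrable lebesgue {0<..} (\<lambda>t. if t < r then f t else g t)"
    and "(LINT t:{0<..}|lebesgue. if t < r then f t else g t)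
           = (LINT t:{0<..<r}|lebesgue. f t) + (LINT t:{r..}|lebesgue. g t)"
proof -
  let ?h = "\<lambda>t. if t < r then f t else g t"
  have U: "{0<..} = {0<..<r} \<union> {r..}" using r by auto
  have 1: "set_integrable lebesgue {0<..<r} ?h"
    using f by (subst set_integrable_cong[OF refl refl, where f'=f]) auto
  have 2: "set_integrable lebesgue {r..} ?h"
    using g by (subst set_integrable_cong[OF refl refl, where f'=g]) auto
  show "set_integrable lebesgue {0<..} ?h"
    unfolding U by (rule set_integrable_Un[OF 1 2]) auto
  have "(LINT t:{0<..}|lebesgue. ?h t) = (LINT t:{0<..<r}|lebesgue. ?h t) + (LINT t:{r..}|lebesgue. ?h t)"
    unfolding U by (rule set_integral_Un[OF _ 1 2]) auto
  also have "(LINT t:{0<..<r}|lebesgue. ?h t) = (LINT t:{0<..<r}|lebesgue. f t)"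
    by (rule set_lebesgue_integral_cong) auto
  also have "(LINT t:{r..}|lebesgue. ?h t) = (LINT t:{r..}|lebesgue. g t)"
    by (rule set_lebesgue_integral_cong) auto
  finally show "(LINT t:{0<..}|lebesgue. ?h t)
           = (LINT t:{0<..<r}|lebesgue. f t) + (LINT t:{r..}|lebesgue. g t)" .
qed

lemma set_integrable_piecewise_powr:
  fixes r a b d e :: real
  assumes "0 < r" "-1 < d" "e < -1"
  shows "set_integrable lebesgue {0<..} (\<lambda>t. if t < r then a * t powr d else b * t powr e)"
    and "(LINT t:{0<..}|lebesgue. if t < r then a * t powr d else b * t powr e)
           = a * r powr (d + 1) / (d + 1) + b * r powr (e + 1) / (- e - 1)"
  using set_integral_piecewise[OF assms(1) set_integrable_mult_right set_integrable_mult_right,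
      OF set_integrable_powr_0(1)[OF assms(1,2)] set_integrable_powr_tail(1)[OF assms(1,3)], of a b]
  by (simp_all add: set_integrable_powr_0(2)[OF assms(1,2)] set_integrable_powr_tail(2)[OF assms(1,3)])

text \<open>The numerator bounds the drop in the second difference of a bump of height 1 and radius
  r. The value of the integral is the price of one direction in the operator; its scaling r^(-2s)
  governs all later comparisons.\<close>

lemma truncated_square_kernel:
  fixes s r :: real
  assumes s: "0 < s" "s < 1" and r: "0 < r"
  shows "set_integrable lebesgue {0<..} (\<lambda>t. min (2 * (t / r)\<^sup>2) 2 / t powr (1 + 2 * s))"
    and "(LINT t:{0<..}|lebesgue. min (2 * (t / r)\<^sup>2) 2 / t powr (1 + 2 * s))
           = (1 / s + 1 / (1 - s)) * r powr (- 2 * s)"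
proof -
  have eq: "min (2 * (t / r)\<^sup>2) 2 / t powr (1 + 2 * s)
      = (if t < r then (2 / r\<^sup>2) * t powr (1 - 2 * s) else 2 * t powr (-1 - 2 * s))"
    if "t \<in> {0<..}" for t
  proof -
    have t: "0 < t" using that by auto
    have a: "1 / t powr (1 + 2 * s) = t powr (-1 - 2 * s)"
      by (simp add: powr_minus_divide[symmetric])
    have b: "t\<^sup>2 / t powr (1 + 2 * s) = t powr (1 - 2 * s)"
      using t powr_diff[of t 2 "1 + 2 * s"] by (simp add: powr_numeral)
    show ?thesis
    proof (cases "t < r")
      case True
      then have "(t / r)\<^sup>2 \<le> 1" using t by (simp add: power_le_one)
      then have "min (2 * (t / r)\<^sup>2) 2 = 2 / r\<^sup>2 * t\<^sup>2" by (simp add: power_divide)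
      then show ?thesis using True b by (metis times_divide_eq_right)
    next
      case False
      then have "1 \<le> (t / r)\<^sup>2" using t r by (simp add: one_le_power)
      then have "min (2 * (t / r)\<^sup>2) 2 = 2" by simp
      then show ?thesis using False a by (metis times_divide_eq_right mult.right_neutral)
    qed
  qed
  let ?g = "\<lambda>t. if t < r then (2 / r\<^sup>2) * t powr (1 - 2 * s) else 2 * t powr (-1 - 2 * s)"
  have g: "set_integrable lebesgue {0<..} ?g"
    "(LINT t:{0<..}|lebesgue. ?g t) = (2 / r\<^sup>2) * r powr (1 - 2 * s + 1) / (1 - 2 * s + 1)
        + 2 * r powr (-1 - 2 * s + 1) / (- (-1 - 2 * s) - 1)"
    using set_integrable_piecewise_powr[of r "1 - 2 * s" "-1 - 2 * s" "2 / r\<^sup>2" 2] s r by auto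
  show "set_integrable lebesgue {0<..} (\<lambda>t. min (2 * (t / r)\<^sup>2) 2 / t powr (1 + 2 * s))"
    by (subst set_integrable_cong[OF refl refl eq]) (use g in auto)
  have "(LINT t:{0<..}|lebesgue. min (2 * (t / r)\<^sup>2) 2 / t powr (1 + 2 * s)) = (LINT t:{0<..}|lebesgue. ?g t)"
    by (rule set_lebesgue_integral_cong) (use eq in auto)
  also have "\<dots> = (1 / s + 1 / (1 - s)) * r powr (- 2 * s)"
  proof -
    have "r powr (1 - 2 * s + 1) = r\<^sup>2 * r powr (- 2 * s)"
      using r powr_add[of r 2 "- 2 * s"] by (simp add: powr_numeral)
    then show ?thesis unfolding g(2) using r s by (simp add: field_simps)
  qed
  finally show "(LINT t:{0<..}|lebesgue. min (2 * (t / r)\<^sup>2) 2 / t powr (1 + 2 * s))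
           = (1 / s + 1 / (1 - s)) * r powr (- 2 * s)" .
qed

lemma C2_on_quadratic:
  fixes z :: "'a::euclidean_space"
  shows "C2_on S (\<lambda>x. a + b * (norm (x - z))\<^sup>2)"
proof -
  define T :: "'a \<Rightarrow>\<^sub>L 'a \<Rightarrow>\<^sub>L real" where "T = Blinfun blinfun_inner_right"
  have T: "blinfun_apply T = blinfun_inner_right"
    unfolding T_def by (rule bounded_linear_Blinfun_apply) (rule bounded_linear_blinfun_inner_right)
  have "C2_derivs_on S (\<lambda>x. a + b * (norm (x - z))\<^sup>2)
      (\<lambda>x. (2 * b) *\<^sub>R blinfun_inner_right (x - z)) (\<lambda>x. (2 * b) *\<^sub>R T)"
    unfolding C2_derivs_on_def
  proof (intro conjI ballI)
    fix x assume "x \<in> S"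
    show "((\<lambda>x. a + b * (norm (x - z))\<^sup>2) has_derivative
        blinfun_apply ((2 * b) *\<^sub>R blinfun_inner_right (x - z))) (at x within S)"
      unfolding power2_norm_eq_inner
      by (rule has_derivative_eq_rhs, (rule derivative_intros)+)
        (auto simp: fun_eq_iff blinfun.scaleR_left inner_commute algebra_simps)
    show "((\<lambda>x. (2 * b) *\<^sub>R blinfun_inner_right (x - z)) has_derivative
        blinfun_apply ((2 * b) *\<^sub>R T)) (at x within S)"
      by (rule has_derivative_eq_rhs,
          (rule derivative_intros bounded_linear.has_derivative[OF bounded_linear_blinfun_inner_right])+)
        (auto simp: fun_eq_iff blinfun.scaleR_left T)
  qed auto
  then show ?thesis unfolding C2_on_def by blast
qed

section \<open>Minima of lower semicontinuous functions on compact sets\<close>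

lemma lsc_attains_inf:
  fixes u :: "'a::euclidean_space \<Rightarrow> real"
  assumes lsc: "lsc_on S u" and K: "compact K" "K \<noteq> {}" "K \<subseteq> S"
    and g: "continuous_on K g" and bd: "\<And>x. x \<in> K \<Longrightarrow> 0 \<le> u x"
  obtains x where "x \<in> K" "\<And>y. y \<in> K \<Longrightarrow> u x - g x \<le> u y - g y"
proof -
  let ?v = "\<lambda>x. u x - g x"
  have "bounded (g ` K)" using g K compact_continuous_image compact_imp_bounded by blast
  then obtain M where M: "\<And>x. x \<in> K \<Longrightarrow> \<bar>g x\<bar> \<le> M" by (auto simp: bounded_iff)
  have bb: "bdd_below (?v ` K)"
    by (rule bdd_belowI2[of _ "-M"]) (use M bd in force)
  define I where "I = Inf (?v ` K)"
  have "\<exists>x\<in>K. ?v x < I + 1 / real (Suc n)" for n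
  proof -
    have "Inf (?v ` K) < I + 1 / real (Suc n)" unfolding I_def by simp
    from cInf_lessD[OF _ this] K show ?thesis by auto
  qed
  then obtain X where X: "\<And>n. X n \<in> K" "\<And>n. ?v (X n) < I + 1 / real (Suc n)" by metis
  obtain l r where l: "l \<in> K" "strict_mono r" "(X \<circ> r) \<longlonglongrightarrow> l"
    using K(1) X(1) unfolding compact_def by metis
  have gl: "(\<lambda>n. g (X (r n))) \<longlonglongrightarrow> g l"
    using continuous_on_tendsto_compose[OF g l(3)[unfolded o_def] l(1)] X(1) by auto
  have "?v l \<le> I"
  proof (rule ccontr)
    assume "\<not> ?v l \<le> I"
    define e where "e = (?v l - I) / 4"
    have e: "0 < e" using \<open>\<not> ?v l \<le> I\<close> by (simp add: e_def)
    have "\<forall>\<^sub>F y in at l within S. u l - e < u y"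
      using lsc l(1) K(3) e unfolding lsc_on_def by auto
    \<comment> \<open>The filter \<open>at l within S\<close> leaves out l, which the subsequence
      may visit; at l itself the inequality holds because e > 0.\<close>
    then have "\<forall>\<^sub>F y in inf (nhds l) (principal S). u l - e < u y"
      using e by (auto simp: eventually_at_filter eventually_inf_principal elim!: eventually_mono)
    moreover have "filterlim (\<lambda>n. X (r n)) (inf (nhds l) (principal S)) sequentially"
      using l(3) X(1) K(3) unfolding filterlim_inf filterlim_principal
      by (auto simp: o_def intro!: always_eventually)
    ultimately have 1: "\<forall>\<^sub>F n in sequentially. u l - e < u (X (r n))"
      by (rule eventually_compose_filterlim)
    have 2: "\<forall>\<^sub>F n in sequentially. g (X (r n)) < g l + e"
      using gl e by (simp add: order_tendsto_iff)
    have "(\<lambda>n. 1 / real (Suc n)) \<longlonglongrightarrow> 0" using LIMSEQ_inverse_real_of_nat by (simp add: field_simps)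
    then have 3: "\<forall>\<^sub>F n in sequentially. 1 / real (Suc n) < e"
      using e by (simp add: order_tendsto_iff)
    have "\<forall>\<^sub>F n in sequentially. False"
      using 1 2 3[THEN eventually_subseq[OF l(2)]]
    proof eventually_elim
      case (elim n)
      have "u l - g l = I + 4 * e" by (simp add: e_def field_simps)
      then show False using X(2)[of "r n"] e elim by linarith
    qed
    then show False by simp
  qed
  moreover have "I \<le> ?v y" if "y \<in> K" for y unfolding I_def using bb that by (simp add: cInf_lower)
  ultimately show ?thesis using that l(1) order_trans by metis
qed

section \<open>Touching a supersolution with bumps\<close>

text \<open>The real supremum dominates its members only for a set bounded above. A bound M common
  to all directions suffices, since every frame has exactly k members.\<close>

lemma frac_plus_upper:
  assumes B: "B \<in> orthonormal_families k" and C: "0 \<le> C s"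
    and bd: "\<And>\<xi>. norm \<xi> = 1 \<Longrightarrow> frac_dir C s \<xi> u x \<le> M"
  shows "(\<Sum>\<xi>\<in>B. frac_dir C s \<xi> u x) \<le> frac_plus C s k u x"
  unfolding frac_plus_def
proof (rule cSUP_upper[OF B])
  show "bdd_above ((\<lambda>B. \<Sum>\<xi>\<in>B. frac_dir C s \<xi> u x) ` orthonormal_families k)"
  proof (rule bdd_aboveI2[where M = "real k * M"])
    fix B :: "'a set" assume "B \<in> orthonormal_families k"
    then show "(\<Sum>\<xi>\<in>B. frac_dir C s \<xi> u x) \<le> real k * M"
      using sum_bounded_above[of B "\<lambda>\<xi>. frac_dir C s \<xi> u x" M] bd
      by (auto simp: orthonormal_families_def)
  qed
qed

lemma orthonormal_family_containing:
  fixes \<xi> :: "'a::euclidean_space"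
  assumes "norm \<xi> = 1" "1 \<le> k" "k \<le> DIM('a)"
  obtains B where "B \<in> orthonormal_families k" "\<xi> \<in> B"
proof -
  obtain S where S: "\<xi> \<in> S" "pairwise orthogonal S" "\<And>x. x \<in> S \<Longrightarrow> norm x = 1"
    "independent S" "card S = DIM('a)" "span S = UNIV"
    using vector_in_orthonormal_basis[OF assms(1)] by metis
  have fin: "finite S" using S(4) by (simp add: independent_imp_finite)
  then have "k - 1 \<le> card (S - {\<xi>})" using S assms by simp
  then obtain T where T: "T \<subseteq> S - {\<xi>}" "card T = k - 1" "finite T"
    using obtain_subset_with_card_n by metis
  have "insert \<xi> T \<in> orthonormal_families k"
    using T S assms pairwise_subset[OF S(2), of "insert \<xi> T"]
    by (auto simp: orthonormal_families_def card_insert_if)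
  then show ?thesis using that by blast
qed

text \<open>A truncated paraboloid. The kink on the sphere of radius r is harmless: the viscosity
  test asks for smoothness only in a small ball around the touching point, which lies inside the
  sphere, where the bump is exactly quadratic.\<close>

definition bump :: "'a::euclidean_space \<Rightarrow> real \<Rightarrow> real \<Rightarrow> 'a \<Rightarrow> real" where
  "bump z r h x = h * max 0 (1 - (norm (x - z) / r)\<^sup>2)"

lemma bump_bounds: "0 \<le> h \<Longrightarrow> 0 \<le> bump z r h x" "0 \<le> h \<Longrightarrow> bump z r h x \<le> h"
  unfolding bump_def by (auto intro!: mult_left_le)

lemma bump_in_ball: "0 < r \<Longrightarrow> x \<in> cball z r \<Longrightarrow> bump z r h x = h * (1 - (norm (x - z) / r)\<^sup>2)"
  by (simp add: bump_def dist_norm norm_minus_commute power_le_one max_def)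

lemma bump_outside: "0 < r \<Longrightarrow> x \<notin> ball z r \<Longrightarrow> bump z r h x = 0"
proof -
  assume "0 < r" "x \<notin> ball z r"
  then have "1 \<le> (norm (x - z) / r)\<^sup>2"
    by (intro one_le_power) (simp add: dist_norm norm_minus_commute)
  then show ?thesis by (simp add: bump_def max_def)
qed

text \<open>With squared distances for a, b, c and the squared step for t, the hypothesis is the
  parallelogram law; d is a vertical shift of the paraboloid.\<close>

lemma quadratic_second_difference:
  fixes a b c t h d R :: real
  assumes "a + b = 2 * c + 2 * t"
  shows "(h * (1 - a / R) - d) + (h * (1 - b / R) - d) - 2 * (h * (1 - c / R) - d) = - h * (2 * (t / R))"
proof -
  have "a / R + b / R = 2 * (c / R) + 2 * (t / R)" using assms by (simp flip: add_divide_distrib)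
  then have "h * (a / R + b / R) = h * (2 * (c / R) + 2 * (t / R))" by simp
  then show ?thesis by (simp add: algebra_simps)
qed

text \<open>The full paraboloid lies below the bump and agrees with it at x, which gives the
  quadratic bound; the bound by 2 h only uses that the bump takes values in [0, h].\<close>

lemma bump_second_difference:
  fixes z :: "'a::euclidean_space"
  assumes r: "0 < r" and h: "0 \<le> h" and x: "x \<in> ball z r" and \<xi>: "norm \<xi> = 1"
  shows "- h * min (2 * (t / r)\<^sup>2) 2
    \<le> bump z r h (x + t *\<^sub>R \<xi>) + bump z r h (x - t *\<^sub>R \<xi>) - 2 * bump z r h x"
proof -
  let ?b = "\<lambda>x. h * (1 - (norm (x - z) / r)\<^sup>2)"
  have le: "?b y \<le> bump z r h y" for y unfolding bump_def by (intro mult_left_mono h) auto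
  have eq: "bump z r h x = ?b x" using bump_in_ball[OF r, of x z h] x by auto
  have "(norm (x + t *\<^sub>R \<xi> - z))\<^sup>2 + (norm (x - t *\<^sub>R \<xi> - z))\<^sup>2 = 2 * (norm (x - z))\<^sup>2 + 2 * t\<^sup>2"
  proof -
    have "\<xi> \<bullet> \<xi> = 1" using \<xi> by (simp add: norm_eq_1)
    then show ?thesis
      unfolding power2_norm_eq_inner
      by (simp add: inner_diff inner_add algebra_simps power2_eq_square inner_commute)
  qed
  from quadratic_second_difference[OF this, of h "r\<^sup>2" 0]
  have "?b (x + t *\<^sub>R \<xi>) + ?b (x - t *\<^sub>R \<xi>) - 2 * ?b x = - h * (2 * (t / r)\<^sup>2)"
    by (simp add: power_divide)
  then have 1: "- h * (2 * (t / r)\<^sup>2)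
      \<le> bump z r h (x + t *\<^sub>R \<xi>) + bump z r h (x - t *\<^sub>R \<xi>) - 2 * bump z r h x"
    using le[of "x + t *\<^sub>R \<xi>"] le[of "x - t *\<^sub>R \<xi>"] eq by linarith
  have 2: "- h * 2 \<le> bump z r h (x + t *\<^sub>R \<xi>) + bump z r h (x - t *\<^sub>R \<xi>) - 2 * bump z r h x"
    using bump_bounds(1)[OF h, of z r "x + t *\<^sub>R \<xi>"] bump_bounds(1)[OF h, of z r "x - t *\<^sub>R \<xi>"]
      bump_bounds(2)[OF h, of z r x] by linarith
  show ?thesis using 1 2 by (simp add: min_def)
qed

lemma bump_touches:
  fixes u :: "'a::euclidean_space \<Rightarrow> real"
  assumes lsc: "lsc_on S u" and sub: "cball z r \<subseteq> S" and pos: "\<And>x. 0 \<le> u x"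
    and r: "0 < r" and h: "0 < h"
    and x1: "x1 \<in> ball z r" "u x1 \<le> bump z r h x1"
  obtains x2 c where "x2 \<in> ball z r" "0 \<le> c" "u x2 = bump z r h x2 - c" "\<And>y. bump z r h y - c \<le> u y"
proof -
  let ?b = "bump z r h"
  have cont: "continuous_on (cball z r) ?b"
    unfolding bump_def by (intro continuous_intros) (use r in auto)
  obtain x where x: "x \<in> cball z r" "\<And>y. y \<in> cball z r \<Longrightarrow> u x - ?b x \<le> u y - ?b y"
    using lsc_attains_inf[OF lsc compact_cball _ sub cont] pos r by auto
  have le: "u x - ?b x \<le> u x1 - ?b x1" using x(2) x1(1) by auto
  \<comment> \<open>A minimum of \<open>u - bump\<close> attained on the sphere is nonnegative
    there, because the bump vanishes. Then x1, where the difference is at most 0, is a minimizer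
    too, and it is interior. Outside the ball the lowered bump is at most 0, so the comparison
    becomes global.\<close>
  define x2 where "x2 = (if x \<in> ball z r then x else x1)"
  have x2: "x2 \<in> ball z r" using x1 by (simp add: x2_def)
  have min: "u x2 - ?b x2 \<le> u y - ?b y" if "y \<in> cball z r" for y
  proof (cases "x \<in> ball z r")
    case True then show ?thesis using x(2) that by (simp add: x2_def)
  next
    case False
    then have "0 \<le> u x - ?b x" using bump_outside[OF r False] pos[of x] by simp
    then show ?thesis using x(2)[OF that] False x1(2) by (simp add: x2_def)
  qed
  have neg: "u x2 - ?b x2 \<le> 0" using min[of x1] x1 by auto
  have "?b y - (?b x2 - u x2) \<le> u y" for y
  proof (cases "y \<in> cball z r")
    case True then show ?thesis using min by fastforce
  next
    case False
    then have "?b y = 0" using bump_outside[OF r, of y] by auto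
    then show ?thesis using neg pos[of y] by auto
  qed
  then show ?thesis using that[OF x2, of "?b x2 - u x2"] neg by auto
qed

text \<open>The frame is chosen to contain \<xi>. All k directions pay the price of the bump, and
  \<xi> also collects the gain from a segment where u is at least m. It serves in two regimes: gain
  kept and f dropped, for propagation; gain zero and f kept, for the bound on u^p.\<close>

lemma supersolution_bump_test:
  fixes u :: "'b::euclidean_space \<times> real \<Rightarrow> real"
  assumes super: "viscosity_supersolution (frac_plus C s k) s f u"
    and s: "0 < s" "s < 1" and C: "0 < C s" and pos: "\<And>x. 0 \<le> u x"
    and k: "1 \<le> k" "k \<le> DIM('b \<times> real)"
    and r: "0 < r" and h: "0 < h" and sub: "cball z r \<subseteq> half_space"
    and x: "x \<in> ball z r" and c: "0 \<le> c" and ux: "u x = bump z r h x - c"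
    and touch: "\<And>y. bump z r h y - c \<le> u y"
    and \<xi>: "norm \<xi> = 1" and ab: "0 < a" "a \<le> b" and m: "h \<le> m"
    and seg: "\<And>t. a \<le> t \<Longrightarrow> t < b \<Longrightarrow> m \<le> u (x + t *\<^sub>R \<xi>)"
  shows "C s * (m - h) * (b - a) * b powr (-1 - 2 * s) + f x (u x)
    \<le> C s * k * h * (1 / s + 1 / (1 - s)) * r powr (- 2 * s)"
proof -
  let ?b = "bump z r h"
  have xh: "x \<in> half_space" using x sub by auto
  obtain r' where r': "0 < r'" "ball x r' \<subseteq> ball z r" 
    using x open_ball open_contains_ball by metis
  \<comment> \<open>The test ball must stay inside the bump's ball, where the bump is quadratic, and
    must not reach the segment starting at distance a, where the values of u are to be used.\<close>
  define q where "q = min (r' / 2) (a / 2)"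
  have q: "0 < q" "q < a" "cball x q \<subseteq> ball z r"
    using r' ab by (auto simp: q_def subset_iff)
  define Q where "Q = (\<lambda>y. (h - c) + (- h / r\<^sup>2) * (norm (y - z))\<^sup>2)"
  have Q_alt: "Q = (\<lambda>y. h * (1 - (norm (y - z))\<^sup>2 / r\<^sup>2) - c)"
    by (simp add: Q_def algebra_simps)
  have Q: "Q y = ?b y - c" if "y \<in> ball z r" for y
    using bump_in_ball[OF r, of y z h] that by (simp add: Q_alt power_divide)
  define \<psi> where "\<psi> = (\<lambda>y. if y \<in> ball x q then Q y else u y)"
  have vis: "frac_plus C s k \<psi> x + f x (u x) \<le> 0"
  proof -
    have cond: "ball x q \<subseteq> half_space \<and> C2_on (cball x q) Q \<and> Q x = u x \<and> (\<forall>y\<in>ball x q. Q y \<le> u y)"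
    proof (intro conjI ballI)
      show "ball x q \<subseteq> half_space" using q(3) sub by (meson ball_subset_cball subset_trans)
      show "C2_on (cball x q) Q" unfolding Q_def by (rule C2_on_quadratic)
      show "Q x = u x" using Q[OF x] ux by simp
      fix y assume "y \<in> ball x q"
      then have "y \<in> ball z r" using q(3) ball_subset_cball by blast
      then show "Q y \<le> u y" using Q touch by simp
    qed
    have "\<forall>x0\<in>half_space. \<forall>r>0. \<forall>\<phi>.
        ball x0 r \<subseteq> half_space \<and> C2_on (cball x0 r) \<phi> \<and>
        \<phi> x0 = u x0 \<and> (\<forall>x\<in>ball x0 r. \<phi> x \<le> u x) \<longrightarrow>
        frac_plus C s k (\<lambda>x. if x \<in> ball x0 r then \<phi> x else u x) x0 + f x0 (u x0) \<le> 0"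
      using super unfolding viscosity_supersolution_def by (elim conjE)
    from this[rule_format, OF xh q(1) cond] show ?thesis unfolding \<psi>_def .
  qed
  have low: "?b y - c \<le> \<psi> y" for y
    using touch[of y] Q[of y] subsetD[OF q(3), of y] unfolding \<psi>_def by auto
  have \<psi>x: "\<psi> x = ?b x - c" using ux Q[OF x] by (simp add: \<psi>_def)
  have uS: "u \<in> class_S s" using super by (simp add: viscosity_supersolution_def)
  obtain \<alpha> A where \<alpha>: "0 \<le> \<alpha>" "\<alpha> < 2 * s" "0 < A" "\<And>y. \<bar>u y\<bar> \<le> A * (1 + norm y) powr \<alpha>"
    using uS unfolding class_S_def mem_Collect_eq by (elim conjE exE) (rule that, assumption+, erule spec)
  have meas0: "\<And>\<zeta>. norm \<zeta> = 1 \<Longrightarrow> (\<lambda>t. u (x + t *\<^sub>R \<zeta>)) \<in> borel_measurable lebesgue"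
    using uS xh unfolding class_S_def mem_Collect_eq by (elim conjE) (drule (1) bspec, erule allE, erule (1) mp)
  define D where "D = (\<lambda>\<zeta> t. (\<psi> (x + t *\<^sub>R \<zeta>) + \<psi> (x - t *\<^sub>R \<zeta>) - 2 * \<psi> x) / t powr (1 + 2 * s))"
  have fd: "frac_dir C s \<zeta> \<psi> x = C s * (LINT t:{0<..}|lebesgue. D \<zeta> t)" for \<zeta>
    by (simp add: frac_dir_def D_def)
  have meas1: "(\<lambda>t. \<psi> (x + t *\<^sub>R \<zeta>)) \<in> borel_measurable lebesgue" if \<zeta>: "norm \<zeta> = 1" for \<zeta>
  proof -
    have "(\<lambda>t. \<psi> (x + t *\<^sub>R \<zeta>)) = (\<lambda>t. if t \<in> {-q<..<q} then Q (x + t *\<^sub>R \<zeta>) else u (x + t *\<^sub>R \<zeta>))"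
      using \<zeta> by (intro ext) (simp add: \<psi>_def dist_norm abs_less_iff conj_commute)
    moreover have "(\<lambda>t. Q (x + t *\<^sub>R \<zeta>)) \<in> borel_measurable lebesgue"
    proof -
      have "(\<lambda>t. Q (x + t *\<^sub>R \<zeta>)) \<in> borel_measurable borel"
        unfolding Q_def by (intro borel_measurable_continuous_onI continuous_intros)
      then show ?thesis by (simp add: measurable_completion)
    qed
    ultimately show ?thesis
      using measurable_If_set[of "\<lambda>t. Q (x + t *\<^sub>R \<zeta>)" lebesgue borel "\<lambda>t. u (x + t *\<^sub>R \<zeta>)" "{-q<..<q}"]
        meas0[OF \<zeta>] by simp
  qed
  have measD: "set_borel_measurable lebesgue {0<..} (D \<zeta>)" if \<zeta>: "norm \<zeta> = 1" for \<zeta>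
  proof -
    have 1: "(\<lambda>t. \<psi> (x - t *\<^sub>R \<zeta>)) \<in> borel_measurable lebesgue"
      using meas1[of "- \<zeta>"] \<zeta> by simp
    have 2: "(\<lambda>t::real. t powr (1 + 2 * s)) \<in> borel_measurable lebesgue"
      by (intro measurable_completion) auto
    have "(\<lambda>t. D \<zeta> t) \<in> borel_measurable lebesgue"
      unfolding D_def by (intro borel_measurable_divide borel_measurable_add borel_measurable_diff meas1[OF \<zeta>] 1 2) auto
    then show ?thesis
      unfolding set_borel_measurable_def by (intro borel_measurable_scaleR borel_measurable_indicator) auto
  qed
  \<comment> \<open>For t \<ge> q the constants 1 + norm x and \<bar>\<psi> x\<bar> are absorbed
    into multiples of t^\<alpha>, which explains the divisions by q. Below q the second difference
    is an exact multiple of t^2. The two ranges are integrable because s < 1 and \<alpha> < 2 *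
    s.\<close>
  define M where "M = 2 * A * ((1 + norm x) / q + 1) powr \<alpha> + 2 * \<bar>\<psi> x\<bar> / q powr \<alpha>"
  define E where "E = (\<lambda>t. if t < q then (2 * h / r\<^sup>2) * t powr (1 - 2 * s) else M * t powr (\<alpha> - 1 - 2 * s))"
  have E: "set_integrable lebesgue {0<..} E"
    unfolding E_def by (rule set_integrable_piecewise_powr) (use q s \<alpha> in auto)
  have DE: "\<bar>D \<zeta> t\<bar> \<le> E t" if \<zeta>: "norm \<zeta> = 1" and t: "0 < t" for \<zeta> t
  proof (cases "t < q")
    case True
    have in_q: "x + t *\<^sub>R \<zeta> \<in> ball x q" "x - t *\<^sub>R \<zeta> \<in> ball x q" using True t \<zeta> by (auto simp: dist_norm)
    have \<zeta>\<zeta>: "\<zeta> \<bullet> \<zeta> = 1" using \<zeta> by (simp add: norm_eq_1)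
    have "(norm (x + t *\<^sub>R \<zeta> - z))\<^sup>2 + (norm (x - t *\<^sub>R \<zeta> - z))\<^sup>2 = 2 * (norm (x - z))\<^sup>2 + 2 * t\<^sup>2"
      using \<zeta>\<zeta> unfolding power2_norm_eq_inner
      by (simp add: inner_diff inner_add algebra_simps power2_eq_square inner_commute)
    from quadratic_second_difference[OF this, of h "r\<^sup>2" c]
    have "\<psi> (x + t *\<^sub>R \<zeta>) + \<psi> (x - t *\<^sub>R \<zeta>) - 2 * \<psi> x = - (2 * h / r\<^sup>2) * t\<^sup>2"
      using in_q q(1) unfolding \<psi>_def Q_alt by simp
    then have "\<bar>D \<zeta> t\<bar> = (2 * h / r\<^sup>2) * (t\<^sup>2 / t powr (1 + 2 * s))"
      using h r by (simp add: D_def abs_mult)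
    also have "t\<^sup>2 / t powr (1 + 2 * s) = t powr (1 - 2 * s)"
      using t powr_diff[of t 2 "1 + 2 * s"] by (simp add: powr_numeral)
    finally show ?thesis using True by (simp add: E_def)
  next
    case False
    have out: "\<psi> (x + t *\<^sub>R \<zeta>) = u (x + t *\<^sub>R \<zeta>)" "\<psi> (x - t *\<^sub>R \<zeta>) = u (x - t *\<^sub>R \<zeta>)"
      using False t \<zeta> by (auto simp: \<psi>_def dist_norm)
    have ub: "\<bar>u y\<bar> \<le> A * ((1 + norm x) / q + 1) powr \<alpha> * t powr \<alpha>" if "norm y \<le> norm x + t" for y
    proof -
      have "1 + norm x \<le> (1 + norm x) / q * t"
        using False q(1) mult_right_mono[of q t "1 + norm x"]
        by (simp add: pos_le_divide_eq mult.commute)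
      then have "1 + norm y \<le> ((1 + norm x) / q + 1) * t"
        using that by (simp add: algebra_simps)
      then have "(1 + norm y) powr \<alpha> \<le> (((1 + norm x) / q + 1) * t) powr \<alpha>"
        by (intro powr_mono2 \<alpha>) auto
      also have "\<dots> = ((1 + norm x) / q + 1) powr \<alpha> * t powr \<alpha>"
        by (rule powr_mult)
      finally have "A * (1 + norm y) powr \<alpha> \<le> A * (((1 + norm x) / q + 1) powr \<alpha> * t powr \<alpha>)"
        using \<alpha>(3) by (intro mult_left_mono) auto
      then show ?thesis using \<alpha>(4)[of y] by simp
    qed
    have n1: "norm (x + t *\<^sub>R \<zeta>) \<le> norm x + t" "norm (x - t *\<^sub>R \<zeta>) \<le> norm x + t"
      using norm_triangle_ineq[of x "t *\<^sub>R \<zeta>"] norm_triangle_ineq4[of x "t *\<^sub>R \<zeta>"] \<zeta> t by auto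
    have "q powr \<alpha> \<le> t powr \<alpha>" using False q(1) by (intro powr_mono2 \<alpha>) auto
    then have "2 * \<bar>\<psi> x\<bar> \<le> 2 * \<bar>\<psi> x\<bar> / q powr \<alpha> * t powr \<alpha>"
      using q(1) by (simp add: field_simps mult_left_mono)
    then have "\<bar>\<psi> (x + t *\<^sub>R \<zeta>) + \<psi> (x - t *\<^sub>R \<zeta>) - 2 * \<psi> x\<bar> \<le> M * t powr \<alpha>"
      using ub[OF n1(1)] ub[OF n1(2)] unfolding out M_def by (simp add: distrib_right)
    then have "\<bar>D \<zeta> t\<bar> \<le> M * t powr \<alpha> / t powr (1 + 2 * s)"
      unfolding D_def abs_divide by (simp add: divide_right_mono)
    also have "\<dots> = M * t powr (\<alpha> - 1 - 2 * s)"
      using powr_diff[of t \<alpha> "1 + 2 * s"] by (simp add: diff_diff_eq)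
    finally show ?thesis using False by (simp add: E_def)
  qed
  have intD: "set_integrable lebesgue {0<..} (D \<zeta>)" if \<zeta>: "norm \<zeta> = 1" for \<zeta>
    by (rule set_integrable_bound[OF E measD[OF \<zeta>]])
      (use DE[OF \<zeta>] in \<open>auto intro!: always_eventually order_trans[OF DE[OF \<zeta>] abs_ge_self]\<close>)
  define K where "K = (1 / s + 1 / (1 - s)) * r powr (- 2 * s)"
  \<comment> \<open>A majorant independent of the direction keeps the set of frame sums bounded
    above, so that the sum over the chosen frame really is below the supremum.\<close>
  have up: "frac_dir C s \<zeta> \<psi> x \<le> C s * (LINT t:{0<..}|lebesgue. E t)" if \<zeta>: "norm \<zeta> = 1" for \<zeta>
    unfolding fd using C DE[OF \<zeta>] by (intro mult_left_mono set_integral_mono intD \<zeta> E) (auto simp: abs_le_iff)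
  let ?ker = "\<lambda>t. min (2 * (t / r)\<^sup>2) 2 / t powr (1 + 2 * s)"
  have ker: "set_integrable lebesgue {0<..} ?ker" "(LINT t:{0<..}|lebesgue. ?ker t) = K"
    using truncated_square_kernel[OF s r] by (auto simp: K_def)
  have gen: "- h * ?ker t \<le> D \<zeta> t" if \<zeta>: "norm \<zeta> = 1" and t: "0 < t" for \<zeta> t
  proof -
    have "- h * min (2 * (t / r)\<^sup>2) 2 \<le> \<psi> (x + t *\<^sub>R \<zeta>) + \<psi> (x - t *\<^sub>R \<zeta>) - 2 * \<psi> x"
      using bump_second_difference[OF r _ x \<zeta>, of h t] h low[of "x + t *\<^sub>R \<zeta>"] low[of "x - t *\<^sub>R \<zeta>"] \<psi>x
      by auto
    then show ?thesis unfolding D_def by (simp add: divide_right_mono flip: times_divide_eq_right)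
        (metis (no_types, lifting) divide_right_mono minus_mult_left mult_minus_left powr_ge_zero times_divide_eq_right)
  qed
  have dir: "- C s * h * K \<le> frac_dir C s \<zeta> \<psi> x" if \<zeta>: "norm \<zeta> = 1" for \<zeta>
  proof -
    have "(LINT t:{0<..}|lebesgue. - h * ?ker t) \<le> (LINT t:{0<..}|lebesgue. D \<zeta> t)"
      using gen[OF \<zeta>] by (intro set_integral_mono intD \<zeta> set_integrable_mult_right ker) auto
    moreover have "(LINT t:{0<..}|lebesgue. - h * ?ker t) = - h * K"
      unfolding ker(2)[symmetric] by (rule set_integral_mult_right)
    ultimately have "C s * (- h * K) \<le> C s * (LINT t:{0<..}|lebesgue. D \<zeta> t)"
      using C by (intro mult_left_mono) auto
    then show ?thesis unfolding fd by (simp add: algebra_simps)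
  qed
  let ?g = "(m - h) * b powr (-1 - 2 * s)"
  have dir\<xi>: "C s * (?g * (b - a)) - C s * h * K \<le> frac_dir C s \<xi> \<psi> x"
  proof -
    \<comment> \<open>On the segment the value m replaces that of the lowered bump, which is at most
      h: a gain of at least m - h over the general estimate. The weight t^(-1-2s) is at least its
      value at b.\<close>
    let ?i = "\<lambda>t. indicator {a..<b} t * ?g"
    have i: "set_integrable lebesgue {0<..} ?i" "(LINT t:{0<..}|lebesgue. ?i t) = ?g * (b - a)"
    proof -
      have e: "(\<lambda>t. indicator {0<..} t *\<^sub>R ?i t) = (\<lambda>t. ?g * indicator {a..<b} t)"
        using ab by (auto simp: fun_eq_iff indicator_def)
      show "set_integrable lebesgue {0<..} ?i"
        unfolding set_integrable_def e using emeasure_lborel_Ico[OF ab(2)]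
        by (intro integrable_mult_right integrable_real_indicator) auto
      show "(LINT t:{0<..}|lebesgue. ?i t) = ?g * (b - a)"
        unfolding set_lebesgue_integral_def e using ab by simp
    qed
    have "(LINT t:{0<..}|lebesgue. ?i t - h * ?ker t) \<le> (LINT t:{0<..}|lebesgue. D \<xi> t)"
    proof (intro set_integral_mono intD \<xi> set_integral_diff set_integrable_mult_right ker i)
      fix t :: real assume "t \<in> {0<..}"
      then have t: "0 < t" by simp
      show "?i t - h * ?ker t \<le> D \<xi> t"
      proof (cases "t \<in> {a..<b}")
        case True
        have "x + t *\<^sub>R \<xi> \<notin> ball x q" using \<xi> True q by (auto simp: dist_norm)
        then have 1: "m \<le> \<psi> (x + t *\<^sub>R \<xi>)" using seg True by (simp add: \<psi>_def)
        have 2: "?b (x + t *\<^sub>R \<xi>) - c \<le> h" using bump_bounds(2)[of h z r "x + t *\<^sub>R \<xi>"] h c by simp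
        have "(m - h) - h * min (2 * (t / r)\<^sup>2) 2 \<le> \<psi> (x + t *\<^sub>R \<xi>) + \<psi> (x - t *\<^sub>R \<xi>) - 2 * \<psi> x"
          using bump_second_difference[OF r _ x \<xi>, of h t] h low[of "x - t *\<^sub>R \<xi>"] \<psi>x 1 2
          by auto
        then have "((m - h) - h * min (2 * (t / r)\<^sup>2) 2) / t powr (1 + 2 * s) \<le> D \<xi> t"
          unfolding D_def by (rule divide_right_mono) auto
        then have "(m - h) / t powr (1 + 2 * s) - h * ?ker t \<le> D \<xi> t"
          by (simp add: diff_divide_distrib)
        moreover have "(m - h) * b powr (-1 - 2 * s) \<le> (m - h) / t powr (1 + 2 * s)"
        proof -
          have "b powr (-1 - 2 * s) = 1 / b powr (1 + 2 * s)" by (simp add: powr_minus_divide[symmetric])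
          also have "\<dots> \<le> 1 / t powr (1 + 2 * s)"
            using True t s by (intro divide_left_mono powr_mono2 mult_pos_pos) auto
          finally show ?thesis using m by (metis mult.right_neutral diff_ge_0_iff_ge mult_left_mono times_divide_eq_right)
        qed
        ultimately show ?thesis using True by simp
      next
        case False
        then show ?thesis using gen[OF \<xi> t] by simp
      qed
    qed
    moreover have "(LINT t:{0<..}|lebesgue. ?i t - h * ?ker t) = ?g * (b - a) - h * K"
      using set_integral_diff(2)[OF i(1) set_integrable_mult_right[of h, OF ker(1)]] i(2) ker(2)
      by (simp only: set_integral_mult_right)
    ultimately have "C s * (?g * (b - a) - h * K) \<le> C s * (LINT t:{0<..}|lebesgue. D \<xi> t)"
      using C by (intro mult_left_mono) auto
    then show ?thesis unfolding fd by (simp add: algebra_simps)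
  qed
  obtain B where B: "B \<in> orthonormal_families k" "\<xi> \<in> B"
    using orthonormal_family_containing[OF \<xi> k] by metis
  have card: "real (card (B - {\<xi>})) = real k - 1"
    using B k by (simp add: orthonormal_families_def of_nat_diff)
  have "real (card (B - {\<xi>})) * (- C s * h * K) \<le> (\<Sum>\<zeta>\<in>B - {\<xi>}. frac_dir C s \<zeta> \<psi> x)"
    using B dir by (intro sum_bounded_below) (auto simp: orthonormal_families_def)
  then have "(real k - 1) * (- C s * h * K) \<le> (\<Sum>\<zeta>\<in>B - {\<xi>}. frac_dir C s \<zeta> \<psi> x)"
    unfolding card .
  moreover have "(\<Sum>\<zeta>\<in>B. frac_dir C s \<zeta> \<psi> x) = frac_dir C s \<xi> \<psi> x + (\<Sum>\<zeta>\<in>B - {\<xi>}. frac_dir C s \<zeta> \<psi> x)"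
    using B by (intro sum.remove) (auto simp: orthonormal_families_def)
  moreover have "(\<Sum>\<zeta>\<in>B. frac_dir C s \<zeta> \<psi> x) \<le> frac_plus C s k \<psi> x"
    using C up by (intro frac_plus_upper[OF B(1)]) auto
  ultimately have "(real k - 1) * (- C s * h * K) + (C s * (?g * (b - a)) - C s * h * K) + f x (u x) \<le> 0"
    using vis dir\<xi> by linarith
  then have "C s * (m - h) * (b - a) * b powr (-1 - 2 * s) + f x (u x) \<le> C s * k * h * K"
    by (simp add: algebra_simps)
  then show ?thesis unfolding K_def by (simp only: mult.assoc)
qed

section \<open>Propagation of positivity\<close>

text \<open>If the bump exceeded u somewhere, it could be lowered until it touches u at some w. The
  value there is at most h < m, so w is outside the source ball around y, and the direction from w
  to y may be used. Hypothesis \<open>small\<close> says that its gain outweighs the price of k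
  directions.\<close>

lemma supersolution_propagation:
  fixes u :: "'b::euclidean_space \<times> real \<Rightarrow> real"
  assumes super: "viscosity_supersolution (frac_plus C s k) s f u"
    and s: "0 < s" "s < 1" and C: "0 < C s" and pos: "\<And>x. 0 \<le> u x" and f: "\<And>x t. 0 \<le> f x t"
    and k: "1 \<le> k" "k \<le> DIM('b \<times> real)"
    and r: "0 < r" and h: "0 < h" "h < m" and sub: "cball z r \<subseteq> half_space"
    and e: "0 < e" and low: "\<And>x. x \<in> cball y e \<Longrightarrow> m \<le> u x"
    and D: "\<And>x. x \<in> ball z r \<Longrightarrow> dist x y + e \<le> D"
    and small: "k * h * (1 / s + 1 / (1 - s)) * r powr (- 2 * s) < (m - h) * e * D powr (-1 - 2 * s)"
    and x: "x \<in> ball z r"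
  shows "bump z r h x \<le> u x"
proof (rule ccontr)
  assume neg: "\<not> bump z r h x \<le> u x"
  have lsc: "lsc_on half_space u" using super by (simp add: viscosity_supersolution_def)
  have "u x \<le> bump z r h x" using neg by simp
  from bump_touches[OF lsc sub pos r h(1) x this]
  obtain w c where w: "w \<in> ball z r" "0 \<le> c" "u w = bump z r h w - c" "\<And>y. bump z r h y - c \<le> u y"
    by metis
  have "u w \<le> h" using w(2,3) bump_bounds(2)[of h z r w] h by simp
  then have far: "w \<notin> cball y e" using low[of w] h by auto
  define d where "d = dist w y"
  define \<xi> where "\<xi> = (y - w) /\<^sub>R d"
  have d: "e < d" using far by (simp add: d_def dist_commute)
  have "norm (y - w) = d" by (simp add: d_def dist_norm norm_minus_commute)
  then have \<xi>: "norm \<xi> = 1" using d e by (simp add: \<xi>_def)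
  \<comment> \<open>The segment starts at the centre y and runs away from w, so it stays in the
    source ball for a length e, and its far end is at distance d + e, which is at most D.\<close>
  have seg: "m \<le> u (w + t *\<^sub>R \<xi>)" if t: "d \<le> t" "t < d + e" for t
  proof (rule low)
    have "y = w + d *\<^sub>R \<xi>" using d e by (simp add: \<xi>_def)
    then have "dist y (w + t *\<^sub>R \<xi>) = norm ((d - t) *\<^sub>R \<xi>)"
      by (simp add: dist_norm scaleR_left_diff_distrib)
    then show "w + t *\<^sub>R \<xi> \<in> cball y e" using \<xi> t by simp
  qed
  have "C s * (m - h) * ((d + e) - d) * (d + e) powr (-1 - 2 * s) + f w (u w)
    \<le> C s * k * h * (1 / s + 1 / (1 - s)) * r powr (- 2 * s)"
    by (rule supersolution_bump_test[where u=u and f=f, OF super s C pos k r h(1) sub w(1-4) \<xi> _ _ _ seg])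
      (use d e h in auto)
  then have "C s * ((m - h) * e * (d + e) powr (-1 - 2 * s))
      \<le> C s * (k * h * (1 / s + 1 / (1 - s)) * r powr (- 2 * s))"
    using f[of w "u w"] by (simp add: mult.assoc)
  then have "(m - h) * e * (d + e) powr (-1 - 2 * s) \<le> k * h * (1 / s + 1 / (1 - s)) * r powr (- 2 * s)"
    using C by (simp only: mult_le_cancel_left_pos)
  moreover have "D powr (-1 - 2 * s) \<le> (d + e) powr (-1 - 2 * s)"
    using D[OF w(1)] d e s by (intro powr_mono2') (auto simp: d_def)
  then have "(m - h) * e * D powr (-1 - 2 * s) \<le> (m - h) * e * (d + e) powr (-1 - 2 * s)"
    using h e by (intro mult_left_mono) auto
  ultimately show False using small by linarith
qed

section \<open>Comparison of scales and vanishing of subcritical supersolutions\<close>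

lemma powr_unbounded:
  fixes e K :: real
  assumes "0 < e"
  obtains R where "R \<ge> R0" "K < R powr e"
proof (rule that)
  let ?R = "max (max 0 R0) ((\<bar>K\<bar> + 1) powr (1 / e))"
  show "R0 \<le> ?R" by simp
  have "((\<bar>K\<bar> + 1) powr (1 / e)) powr e \<le> ?R powr e"
    using assms by (intro powr_mono2) auto
  then show "K < ?R powr e" using assms by (simp add: powr_powr)
qed

text \<open>Dividing by M R leaves that M R^(p-1) * R^(2s) is bounded. The sign of p - 1 decides
  which bound on M contradicts this: the lower one leaves the exponent 2s - (p - 1), the upper one
  2s - \<alpha> (1 - p), and both are positive.\<close>

lemma growth_contradiction:
  fixes M :: "real \<Rightarrow> real"
  assumes p: "p < 1 + 2 * s" "0 < p" and s: "0 < s" and \<alpha>: "0 \<le> \<alpha>" "\<alpha> < 2 * s"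
    and pos: "0 < a" "0 < b" "0 < A" and R0: "1 \<le> R0"
    and lo: "\<And>R. R0 \<le> R \<Longrightarrow> a / R \<le> M R"
    and up: "\<And>R. R0 \<le> R \<Longrightarrow> M R \<le> A * R powr \<alpha>"
    and eq: "\<And>R. R0 \<le> R \<Longrightarrow> M R powr p \<le> b * M R * R powr (- 2 * s)"
  shows False
proof -
  have Mpos: "0 < M R" if "R0 \<le> R" for R
    using lo[OF that] that R0 pos by (smt (verit) divide_pos_pos)
  have eq': "M R powr (p - 1) * R powr (2 * s) \<le> b" if R: "R0 \<le> R" for R
  proof -
    have "M R powr (p - 1) = M R powr p / M R"
      using Mpos[OF R] by (simp add: powr_diff)
    also have "\<dots> \<le> b * R powr (- 2 * s)"
      using eq[OF R] Mpos[OF R] by (simp add: field_simps)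
    finally have "M R powr (p - 1) * R powr (2 * s) \<le> b * R powr (- 2 * s) * R powr (2 * s)"
      by (intro mult_right_mono) auto
    also have "\<dots> = b" using R R0 by (simp add: mult.assoc flip: powr_add)
    finally show ?thesis .
  qed
  show False
  proof (cases "1 \<le> p")
    case True
    obtain R where R: "R0 \<le> R" "b / a powr (p - 1) < R powr (2 * s - (p - 1))"
      using powr_unbounded[of "2 * s - (p - 1)" R0 "b / a powr (p - 1)"] p by auto
    have "(a / R) powr (p - 1) \<le> M R powr (p - 1)"
      using lo[OF R(1)] True pos R R0 by (intro powr_mono2) auto
    then have "(a / R) powr (p - 1) * R powr (2 * s) \<le> b"
      using eq'[OF R(1)] by (meson mult_right_mono order_trans powr_ge_zero)
    moreover have "(a / R) powr (p - 1) * R powr (2 * s) = a powr (p - 1) * R powr (2 * s - (p - 1))"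
      using R R0 by (simp add: powr_divide powr_diff[of R "2 * s" "p - 1"])
    moreover have "b < a powr (p - 1) * R powr (2 * s - (p - 1))"
      using R(2) pos by (simp add: pos_divide_less_eq mult.commute)
    ultimately show False by simp
  next
    case False
    then have "\<alpha> * (1 - p) < 2 * s"
      using \<alpha> p s by (smt (verit) mult_left_le)
    then obtain R where R: "R0 \<le> R" "b * A powr (1 - p) < R powr (2 * s - \<alpha> * (1 - p))"
      using powr_unbounded[of "2 * s - \<alpha> * (1 - p)" R0 "b * A powr (1 - p)"] by auto
    have "(A * R powr \<alpha>) powr (p - 1) \<le> M R powr (p - 1)"
      using up[OF R(1)] False Mpos[OF R(1)] by (intro powr_mono2') auto
    then have "(A * R powr \<alpha>) powr (p - 1) * R powr (2 * s) \<le> b"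
      using eq'[OF R(1)] by (meson mult_right_mono order_trans powr_ge_zero)
    moreover have "(A * R powr \<alpha>) powr (p - 1) * R powr (2 * s)
        = R powr (2 * s - \<alpha> * (1 - p)) / A powr (1 - p)"
    proof -
      have "(A * R powr \<alpha>) powr (p - 1) = A powr (p - 1) * R powr (\<alpha> * (p - 1))"
        by (simp add: powr_mult powr_powr)
      moreover have "A powr (p - 1) = 1 / A powr (1 - p)" using powr_minus_divide[of A "1 - p"] by simp
      moreover have "R powr (\<alpha> * (p - 1)) * R powr (2 * s) = R powr (2 * s - \<alpha> * (1 - p))"
        by (simp add: algebra_simps flip: powr_add)
      ultimately show ?thesis by simp
    qed
    moreover have "b < R powr (2 * s - \<alpha> * (1 - p)) / A powr (1 - p)"
      using R(2) pos by (simp add: pos_less_divide_eq)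
    ultimately show False by simp
  qed
qed

proposition supersolution_subcritical_zero:
  fixes u :: "'b::euclidean_space \<times> real \<Rightarrow> real"
  assumes super: "viscosity_supersolution (frac_plus C s k) s (\<lambda>x t. t powr p) u"
    and s: "0 < s" "s < 1" and C: "0 < C s" and pos: "\<And>x. 0 \<le> u x"
    and k: "1 \<le> k" "k \<le> DIM('b \<times> real)"
    and p: "0 < p" "p < 1 + 2 * s" and y: "y \<in> half_space"
  shows "u y = 0"
proof (rule ccontr)
  assume "u y \<noteq> 0"
  then have uy: "0 < u y" using pos[of y] by simp
  define m0 where "m0 = u y / 2"
  have m0: "0 < m0" "m0 < u y" using uy by (auto simp: m0_def)
  have lsc: "lsc_on half_space u" using super by (simp add: viscosity_supersolution_def)
  have op: "open (half_space :: ('b \<times> real) set)"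
    unfolding half_space_def by (intro open_Collect_less continuous_intros)
  have "\<forall>\<^sub>F x in at y. m0 < u x"
    using lsc y m0 unfolding lsc_on_def by (simp add: at_within_open[OF _ op])
  then obtain e' where e': "0 < e'" "\<And>x. x \<noteq> y \<Longrightarrow> dist x y < e' \<Longrightarrow> m0 < u x"
    by (auto simp: eventually_at)
  define e where "e = e' / 2"
  have e: "0 < e" "\<And>x. x \<in> cball y e \<Longrightarrow> m0 \<le> u x"
  proof -
    fix x assume "x \<in> cball y e"
    then show "m0 \<le> u x"
      using e'(1) e'(2)[of x] m0(2) by (cases "x = y") (auto simp: e_def dist_commute)
  qed (use e' in \<open>simp add: e_def\<close>)
  define \<Lambda> where "\<Lambda> = 1 / s + 1 / (1 - s)"
  have \<Lambda>: "0 < \<Lambda>" using s by (auto simp: \<Lambda>_def intro: add_pos_pos)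
  \<comment> \<open>Three concentric balls are used: radius R for the minimum, 2 R for the test
    bump, 3 R for the bump that controls u on the ball of radius 2 R. Height 4 R keeps all of them
    inside the half-space.\<close>
  define z :: "real \<Rightarrow> 'b \<times> real" where "z = (\<lambda>R. (0, 4 * R))"
  have zsub: "cball (z R) r \<subseteq> half_space" if "0 < R" "r \<le> 3 * R" for R r
  proof
    fix x assume "x \<in> cball (z R) r"
    then have "\<bar>4 * R - snd x\<bar> \<le> 3 * R"
      using dist_snd_le[of "z R" x] that by (simp add: z_def dist_real_def)
    then show "x \<in> half_space" using that by (simp add: half_space_def abs_le_iff)
  qed
  have nz: "norm (z R) = 4 * R" if "0 < R" for R using that by (simp add: z_def norm_Pair real_sqrt_unique)
  have bump34: "3 / 4 * h \<le> bump (z R) (2 * R) h x" if "0 < R" "0 < h" "x \<in> cball (z R) R" for R h x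
  proof -
    have "norm (x - z R) / (2 * R) \<le> 1 / 2" using that by (simp add: dist_norm norm_minus_commute)
    then have "(norm (x - z R) / (2 * R))\<^sup>2 \<le> (1 / 2)\<^sup>2" using that by (intro power_mono) auto
    then have "3 / 4 \<le> max 0 (1 - (norm (x - z R) / (2 * R))\<^sup>2)" by (simp add: power2_eq_square)
    from this that(2) have "h * (3 / 4) \<le> h * max 0 (1 - (norm (x - z R) / (2 * R))\<^sup>2)"
      by (rule mult_left_mono[OF _ less_imp_le])
    then show ?thesis unfolding bump_def by linarith
  qed
  \<comment> \<open>Beyond R0 a point of the ball of radius 2 R around z R has distance to y,
    increased by e, of at most 2 R + 4 R + R; this explains the 8 R used as D below.\<close>
  define R0 where "R0 = max 1 (norm y + e)"
  have R0: "1 \<le> R0" "norm y + e \<le> R0" by (auto simp: R0_def)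
  text \<open>The decay rate \<open>1 / R\<close>, rather than that of a fundamental solution, comes from the lines
    through the fixed ball around \<open>y\<close>.\<close>
  define c where "c = min (m0 / 2) (m0 / 2 * e * 8 powr (-1 - 2 * s) / (2 * k * \<Lambda> * 2 powr (- 2 * s)))"
  have c: "0 < c" "c \<le> m0 / 2" using m0 e k \<Lambda> by (auto simp: c_def)
  have "c \<le> m0 / 2 * e * 8 powr (-1 - 2 * s) / (2 * k * \<Lambda> * 2 powr (- 2 * s))" by (simp add: c_def)
  then have "c * (2 * k * \<Lambda> * 2 powr (- 2 * s)) \<le> m0 / 2 * e * 8 powr (-1 - 2 * s)"
    using k \<Lambda> by (simp add: pos_le_divide_eq)
  moreover have "0 < k * c * \<Lambda> * 2 powr (- 2 * s)" using c k \<Lambda> by simp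
  ultimately have csmall: "k * c * \<Lambda> * 2 powr (- 2 * s) < m0 / 2 * e * 8 powr (-1 - 2 * s)"
    by (simp add: algebra_simps)
  have A: "3 / 4 * c / R \<le> u x" if R: "R0 \<le> R" and x: "x \<in> cball (z R) R" for R x
  proof -
    have R1: "1 \<le> R" using R R0 by simp
    have "c / R \<le> c / 1" using c R1 by (intro divide_left_mono) auto
    then have "c / R \<le> m0 / 2" using c(2) by (metis div_by_1 order_trans)
    moreover from this have "c / R < m0" using m0 by linarith
    ultimately have h: "0 < c / R" "c / R \<le> m0 / 2" "c / R < m0" using c R1 by simp_all
    have "bump (z R) (2 * R) (c / R) x \<le> u x"
    proof (rule supersolution_propagation[where f = "\<lambda>x t. t powr p" and y = y and e = e and D = "8 * R" and m = m0,
          OF super s C pos _ k])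
      show "dist w y + e \<le> 8 * R" if "w \<in> ball (z R) (2 * R)" for w
      proof -
        have "dist w y \<le> dist (z R) w + norm (z R) + norm y"
          by (smt (verit) dist_commute dist_norm dist_triangle norm_triangle_ineq4)
        then show ?thesis using that nz[of R] R R0 by auto
      qed
      have "k * (c / R) * \<Lambda> * (2 * R) powr (- 2 * s) = (k * c * \<Lambda> * 2 powr (- 2 * s)) * R powr (-1 - 2 * s)"
        using R1 by (simp add: powr_mult powr_diff powr_minus field_simps)
      also have "\<dots> < (m0 / 2 * e * 8 powr (-1 - 2 * s)) * R powr (-1 - 2 * s)"
        using csmall R1 by (intro mult_strict_right_mono) auto
      also have "\<dots> = m0 / 2 * e * (8 * R) powr (-1 - 2 * s)"
        by (simp add: powr_mult)
      also have "\<dots> \<le> (m0 - c / R) * e * (8 * R) powr (-1 - 2 * s)"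
        using h e by (intro mult_right_mono) auto
      finally show "k * (c / R) * (1 / s + 1 / (1 - s)) * (2 * R) powr (- 2 * s)
          < (m0 - c / R) * e * (8 * R) powr (-1 - 2 * s)" unfolding \<Lambda>_def .
      show "x \<in> ball (z R) (2 * R)" using x R1 by auto
    qed (use h(1,3) R1 e zsub in auto)
    moreover have "3 / 4 * (c / R) \<le> bump (z R) (2 * R) (c / R) x"
      by (rule bump34) (use h x R1 in simp_all)
    ultimately show ?thesis by simp
  qed
  \<comment> \<open>This solves the smallness condition of propagation for a source of radius R, a
    bump of radius 3 R and D = 4 R. Both sides scale like m * R^(-2s), so R drops out. The cap 1/2
    keeps m - \<eta> m above m / 2; the factor 2 in the denominator makes the inequality
    strict.\<close>
  define \<eta> where "\<eta> = min (1 / 2) (1 / 2 * 4 powr (-1 - 2 * s) / (2 * k * \<Lambda> * 3 powr (- 2 * s)))"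
  have \<eta>: "0 < \<eta>" "\<eta> \<le> 1 / 2" using k \<Lambda> by (auto simp: \<eta>_def)
  have "\<eta> \<le> 1 / 2 * 4 powr (-1 - 2 * s) / (2 * k * \<Lambda> * 3 powr (- 2 * s))" by (simp add: \<eta>_def)
  then have "\<eta> * (2 * k * \<Lambda> * 3 powr (- 2 * s)) \<le> 1 / 2 * 4 powr (-1 - 2 * s)"
    using k \<Lambda> by (simp add: pos_le_divide_eq)
  moreover have "0 < k * \<eta> * \<Lambda> * 3 powr (- 2 * s)" using \<eta> k \<Lambda> by simp
  ultimately have \<eta>small: "k * \<eta> * \<Lambda> * 3 powr (- 2 * s) < 1 / 2 * 4 powr (-1 - 2 * s)"
    by (simp add: algebra_simps)
  \<comment> \<open>The Harnack-type step: a lower bound on the ball of radius R passes, up to a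
    constant, to the ball of radius 2 R, where the touching point will lie. The factor 5/9 is 1 -
    (2/3)^2, the relative height of the bump of radius 3 R at distance 2 R.\<close>
  have H: "5 / 9 * \<eta> * m \<le> u x"
    if R: "0 < R" and m: "0 < m" and low: "\<And>x. x \<in> cball (z R) R \<Longrightarrow> m \<le> u x"
      and x: "x \<in> ball (z R) (2 * R)" for R m x
  proof -
    have "\<eta> * m \<le> 1 / 2 * m" using \<eta>(2) m by (rule mult_right_mono[OF _ less_imp_le])
    moreover from this have "\<eta> * m < m" using m by linarith
    ultimately have h: "0 < \<eta> * m" "\<eta> * m \<le> 1 / 2 * m" "\<eta> * m < m" using \<eta> m by simp_all
    have "bump (z R) (3 * R) (\<eta> * m) x \<le> u x"
    proof (rule supersolution_propagation[where f = "\<lambda>x t. t powr p" and y = "z R" and e = R and D = "4 * R" and m = m,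
          OF super s C pos _ k])
      show "dist w (z R) + R \<le> 4 * R" if "w \<in> ball (z R) (3 * R)" for w
        using that by (simp add: dist_commute)
      have "k * (\<eta> * m) * \<Lambda> * (3 * R) powr (- 2 * s) = (k * \<eta> * \<Lambda> * 3 powr (- 2 * s)) * (m * R powr (- 2 * s))"
        by (simp add: powr_mult)
      also have "\<dots> < (1 / 2 * 4 powr (-1 - 2 * s)) * (m * R powr (- 2 * s))"
        using \<eta>small R m by (intro mult_strict_right_mono) auto
      also have "\<dots> = 1 / 2 * m * R * (4 * R) powr (-1 - 2 * s)"
        using R by (simp add: powr_mult powr_diff powr_minus field_simps)
      also have "\<dots> \<le> (m - \<eta> * m) * R * (4 * R) powr (-1 - 2 * s)"
        using h R by (intro mult_right_mono) auto
      finally show "k * (\<eta> * m) * (1 / s + 1 / (1 - s)) * (3 * R) powr (- 2 * s)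
          < (m - \<eta> * m) * R * (4 * R) powr (-1 - 2 * s)" unfolding \<Lambda>_def .
      show "x \<in> ball (z R) (3 * R)" using x R by auto
    qed (use h(1,3) R zsub low in auto)
    moreover have "5 / 9 * (\<eta> * m) \<le> bump (z R) (3 * R) (\<eta> * m) x"
    proof -
      have "norm (x - z R) / (3 * R) \<le> 2 / 3"
        using x R by (simp add: dist_norm norm_minus_commute pos_divide_le_eq)
      then have "(norm (x - z R) / (3 * R))\<^sup>2 \<le> (2 / 3)\<^sup>2" using R by (intro power_mono) auto
      then have "5 / 9 \<le> max 0 (1 - (norm (x - z R) / (3 * R))\<^sup>2)" by (simp add: power2_eq_square)
      from this h(1) have "\<eta> * m * (5 / 9) \<le> \<eta> * m * max 0 (1 - (norm (x - z R) / (3 * R))\<^sup>2)"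
        by (rule mult_left_mono[OF _ less_imp_le])
      then show ?thesis unfolding bump_def by linarith
    qed
    ultimately show ?thesis by simp
  qed
  have "\<exists>x\<in>cball (z R) R. \<forall>w\<in>cball (z R) R. u x \<le> u w" if "0 < R" for R
    using lsc_attains_inf[OF lsc compact_cball[of "z R" R] _ zsub continuous_on_const[of _ 0]] pos that
    by (metis cball_eq_empty diff_zero less_imp_le linorder_not_less mult_le_cancel_right1 not_less_iff_gr_or_eq one_le_numeral)
  then obtain X where X: "\<And>R. 0 < R \<Longrightarrow> X R \<in> cball (z R) R"
    "\<And>R w. 0 < R \<Longrightarrow> w \<in> cball (z R) R \<Longrightarrow> u (X R) \<le> u w" by metis
  define M where "M = (\<lambda>R. u (X R))"
  define b where "b = C s * k * (4 / 3) * \<Lambda> * 2 powr (- 2 * s) / (5 / 9 * \<eta>) powr p"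
  obtain \<alpha> A where \<alpha>: "0 \<le> \<alpha>" "\<alpha> < 2 * s" "0 < A" "\<And>y. \<bar>u y\<bar> \<le> A * (1 + norm y) powr \<alpha>"
    using super unfolding viscosity_supersolution_def class_S_def mem_Collect_eq
    by (elim conjE exE) (rule that, assumption+, erule spec)
  show False
  proof (rule growth_contradiction[OF p(2,1) s(1) \<alpha>(1,2), of "3 / 4 * c" b "A * 6 powr \<alpha>" R0 M])
    show "0 < 3 / 4 * c" "0 < A * 6 powr \<alpha>" "1 \<le> R0" using c \<alpha> R0 by auto
    show "0 < b" using C k \<Lambda> \<eta> by (simp add: b_def)
    fix R assume R: "R0 \<le> R"
    then have R1: "1 \<le> R" "0 < R" using R0 by auto
    show Mlow: "3 / 4 * c / R \<le> M R" using A[OF R X(1)] R1 by (simp add: M_def)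
    then have Mpos: "0 < M R" using c R1 by (smt (verit) divide_pos_pos mult_pos_pos)
    have "norm (X R) \<le> 5 * R"
      using X(1)[OF R1(2)] nz[OF R1(2)] norm_triangle_sub[of "X R" "z R"] by (simp add: dist_norm norm_minus_commute)
    then have "(1 + norm (X R)) powr \<alpha> \<le> (6 * R) powr \<alpha>"
      using R1 \<alpha> by (intro powr_mono2) auto
    then have "A * (1 + norm (X R)) powr \<alpha> \<le> A * (6 * R) powr \<alpha>" using \<alpha> by (intro mult_left_mono) auto
    then show "M R \<le> A * 6 powr \<alpha> * R powr \<alpha>"
      using \<alpha>(4)[of "X R"] by (simp add: M_def powr_mult mult.assoc)
    \<comment> \<open>The bump of radius 2 R keeps at least 3/4 of its height on the ball of radius
      R, so with this h it reaches u at the minimum point X R and can be lowered to a touching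
      position.\<close>
    define h where "h = 4 / 3 * M R"
    have h: "0 < h" using Mpos by (simp add: h_def)
    have "u (X R) \<le> bump (z R) (2 * R) h (X R)"
      using bump34[OF R1(2) h X(1)[OF R1(2)]] by (simp add: h_def M_def)
    from bump_touches[OF lsc zsub pos _ h _ this] R1 X(1)[OF R1(2)]
    obtain w d where w: "w \<in> ball (z R) (2 * R)" "0 \<le> d" "u w = bump (z R) (2 * R) h w - d"
      "\<And>x. bump (z R) (2 * R) h x - d \<le> u x" by auto
    obtain \<xi> :: "'b \<times> real" where \<xi>: "norm \<xi> = 1"
      using vector_choose_size[of 1] by (metis zero_le_one)
    \<comment> \<open>An empty segment (a = b = 1) with m = h kills the gain, so any direction will
      do; what remains is the term u^p against the price of the bump.\<close>
    have "C s * (h - h) * (1 - 1) * 1 powr (-1 - 2 * s) + u w powr p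
      \<le> C s * k * h * (1 / s + 1 / (1 - s)) * (2 * R) powr (- 2 * s)"
      by (rule supersolution_bump_test[where u=u and f="\<lambda>x t. t powr p", OF super s C pos k _ h zsub w(1-4) \<xi>])
        (use R1 in auto)
    then have up: "u w powr p \<le> C s * k * h * \<Lambda> * (2 * R) powr (- 2 * s)" by (simp add: \<Lambda>_def)
    have "5 / 9 * \<eta> * M R \<le> u w"
      using H[OF R1(2) Mpos _ w(1)] X(2)[OF R1(2)] by (simp add: M_def)
    then have "(5 / 9 * \<eta> * M R) powr p \<le> u w powr p"
      using \<eta> Mpos p by (intro powr_mono2) auto
    also note up
    finally have "(5 / 9 * \<eta>) powr p * M R powr p \<le> C s * k * h * \<Lambda> * (2 * R) powr (- 2 * s)"
      unfolding powr_mult[of "5 / 9 * \<eta>" "M R" p] .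
    then have "M R powr p \<le> C s * k * h * \<Lambda> * (2 * R) powr (- 2 * s) / (5 / 9 * \<eta>) powr p"
      using \<eta> by (simp add: pos_le_divide_eq mult.commute)
    also have "\<dots> = b * M R * R powr (- 2 * s)" by (simp add: b_def h_def powr_mult)
    finally show "M R powr p \<le> b * M R * R powr (- 2 * s)" .
  qed
qed

section \<open>Second differences of powers\<close>

lemma nonneg_deriv_imp_nonneg:
  fixes f f' :: "real \<Rightarrow> real"
  assumes "0 \<le> Y" "f 0 = 0"
    and "\<And>y. 0 \<le> y \<Longrightarrow> y \<le> Y \<Longrightarrow> (f has_real_derivative f' y) (at y)"
    and "\<And>y. 0 \<le> y \<Longrightarrow> y \<le> Y \<Longrightarrow> 0 \<le> f' y"
  shows "0 \<le> f Y"
  using DERIV_nonneg_imp_nondecreasing[of 0 Y f] assms by metis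

lemma has_derivative_powr_affine:
  fixes A k a t :: real
  assumes "0 < A + k * t"
  shows "((\<lambda>y. (A + k * y) powr a) has_real_derivative a * k * (A + k * t) powr (a - 1)) (at t)"
  using assms by (auto intro!: derivative_eq_intros)

lemma reciprocal_pair_mono:
  fixes A e x y :: real
  assumes "0 \<le> x" "x \<le> y" "y < A" "0 < e"
  shows "(A + x) powr (- e) + (A - x) powr (- e) \<le> (A + y) powr (- e) + (A - y) powr (- e)"
proof (rule DERIV_nonneg_imp_nondecreasing[OF assms(2)])
  fix t assume t: "x \<le> t" "t \<le> y"
  have "((\<lambda>x. (A + x) powr (- e) + (A - x) powr (- e)) has_real_derivative
      e * ((A - t) powr (- e - 1) - (A + t) powr (- e - 1))) (at t)"
    by (rule derivative_eq_intros refl | use t assms in \<open>simp add: algebra_simps\<close>)+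
  moreover have "(A + t) powr (- e - 1) \<le> (A - t) powr (- e - 1)"
    using t assms by (intro powr_mono2') auto
  ultimately show "\<exists>d. ((\<lambda>x. (A + x) powr (- e) + (A - x) powr (- e)) has_real_derivative d) (at t) \<and> 0 \<le> d"
    using assms(4) by (intro exI[of _ "e * ((A - t) powr (- e - 1) - (A + t) powr (- e - 1))"]) auto
qed

text \<open>The map sending \<open>y\<^sup>2\<close> to \<open>(A + y) powr (- e) + (A - y) powr (- e)\<close> is convex; only the
  chord from the origin is needed.\<close>

lemma reciprocal_pair_chord:
  fixes A e c Y :: real
  assumes Y: "0 \<le> Y" "Y < A" and e: "0 < e" and c: "0 \<le> c" "c \<le> 1"
  shows "(A + c * Y) powr (- e) + (A - c * Y) powr (- e)
    \<le> (1 - c\<^sup>2) * (2 * A powr (- e)) + c\<^sup>2 * ((A + Y) powr (- e) + (A - Y) powr (- e))"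
proof -
  have cy: "0 \<le> c * y" "c * y \<le> y" if "0 \<le> y" for y
    using c that by (auto simp: mult_left_le_one_le)
  \<comment> \<open>e * g is the derivative of the pair of powers. One differentiation reduces the
    chord inequality to \<open>g (c * y) <= c * g y\<close>, and another reduces that to
    monotonicity of the pair with exponent e + 2.\<close>
  define g where "g = (\<lambda>y. (A - y) powr (- e - 1) - (A + y) powr (- e - 1))"
  have g: "g (c * y) \<le> c * g y" if y: "0 \<le> y" "y \<le> Y" for y
  proof -
    define f' where "f' = (\<lambda>y. (A + y) powr (- (e + 2)) + (A - y) powr (- (e + 2)))"
    have "0 \<le> c * g y - g (c * y)"
    proof (rule nonneg_deriv_imp_nonneg[OF y(1), where f' = "\<lambda>t. c * ((e + 1) * (f' t - f' (c * t)))"])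
      fix t assume t: "0 \<le> t" "t \<le> y"
      have ct: "c * t < A" "- A < c * t" using cy[OF t(1)] t y Y by auto
      have "((\<lambda>y. c * ((A + (-1) * y) powr (- e - 1) - (A + 1 * y) powr (- e - 1))
            - ((A + (- c) * y) powr (- e - 1) - (A + c * y) powr (- e - 1))) has_real_derivative
          c * ((- e - 1) * (-1) * (A + (-1) * t) powr (- e - 1 - 1) - (- e - 1) * 1 * (A + 1 * t) powr (- e - 1 - 1))
            - ((- e - 1) * (- c) * (A + (- c) * t) powr (- e - 1 - 1) - (- e - 1) * c * (A + c * t) powr (- e - 1 - 1))) (at t)"
        by (intro DERIV_diff DERIV_cmult has_derivative_powr_affine) (use t y Y ct in auto)
      moreover have "(\<lambda>y. c * ((A + (-1) * y) powr (- e - 1) - (A + 1 * y) powr (- e - 1))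
            - ((A + (- c) * y) powr (- e - 1) - (A + c * y) powr (- e - 1))) = (\<lambda>y. c * g y - g (c * y))"
        by (simp add: g_def)
      moreover have "c * ((- e - 1) * (-1) * (A + (-1) * t) powr (- e - 1 - 1) - (- e - 1) * 1 * (A + 1 * t) powr (- e - 1 - 1))
            - ((- e - 1) * (- c) * (A + (- c) * t) powr (- e - 1 - 1) - (- e - 1) * c * (A + c * t) powr (- e - 1 - 1))
          = c * ((e + 1) * (f' t - f' (c * t)))"
        by (simp add: f'_def algebra_simps)
      ultimately show "((\<lambda>y. c * g y - g (c * y)) has_real_derivative c * ((e + 1) * (f' t - f' (c * t)))) (at t)"
        by simp
      have "f' (c * t) \<le> f' t"
        unfolding f'_def using cy[OF t(1)] t y Y e by (intro reciprocal_pair_mono) auto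
      then show "0 \<le> c * ((e + 1) * (f' t - f' (c * t)))" using c e by auto
    qed (simp add: g_def)
    then show ?thesis by simp
  qed
  define \<phi> where "\<phi> = (\<lambda>y. (A + y) powr (- e) + (A - y) powr (- e))"
  have "0 \<le> (1 - c\<^sup>2) * (2 * A powr (- e)) + c\<^sup>2 * \<phi> Y - \<phi> (c * Y)"
  proof (rule nonneg_deriv_imp_nonneg[OF Y(1), where f' = "\<lambda>t. c * e * (c * g t - g (c * t))"])
    show "(1 - c\<^sup>2) * (2 * A powr (- e)) + c\<^sup>2 * \<phi> 0 - \<phi> (c * 0) = 0"
      by (simp add: \<phi>_def algebra_simps)
    fix t assume t: "0 \<le> t" "t \<le> Y"
    have ct: "c * t < A" "- A < c * t" using cy[OF t(1)] t Y by auto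
    have "((\<lambda>y. K + c\<^sup>2 * ((A + 1 * y) powr (- e) + (A + (-1) * y) powr (- e))
            - ((A + c * y) powr (- e) + (A + (- c) * y) powr (- e))) has_real_derivative
          0 + c\<^sup>2 * ((- e) * 1 * (A + 1 * t) powr (- e - 1) + (- e) * (-1) * (A + (-1) * t) powr (- e - 1))
            - ((- e) * c * (A + c * t) powr (- e - 1) + (- e) * (- c) * (A + (- c) * t) powr (- e - 1))) (at t)" for K
      by (intro DERIV_diff DERIV_add DERIV_cmult DERIV_const has_derivative_powr_affine) (use t Y ct in auto)
    moreover have "0 + c\<^sup>2 * ((- e) * 1 * (A + 1 * t) powr (- e - 1) + (- e) * (-1) * (A + (-1) * t) powr (- e - 1))
            - ((- e) * c * (A + c * t) powr (- e - 1) + (- e) * (- c) * (A + (- c) * t) powr (- e - 1))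
          = c * e * (c * g t - g (c * t))"
      by (simp add: g_def algebra_simps power2_eq_square)
    ultimately show "((\<lambda>y. (1 - c\<^sup>2) * (2 * A powr (- e)) + c\<^sup>2 * \<phi> y - \<phi> (c * y)) has_real_derivative
        c * e * (c * g t - g (c * t))) (at t)"
      unfolding \<phi>_def by simp
    show "0 \<le> c * e * (c * g t - g (c * t))" using g[OF t] c e by simp
  qed
  then show ?thesis by (simp add: \<phi>_def)
qed

text \<open>The second difference, with step t, of the function norm powr (- g) at a unit vector,
  along a direction whose cosine with that vector is b.\<close>

definition power_diff :: "real \<Rightarrow> real \<Rightarrow> real \<Rightarrow> real" where
  "power_diff g b t = (1 + t\<^sup>2 + 2 * b * t) powr (- g / 2) + (1 + t\<^sup>2 - 2 * b * t) powr (- g / 2) - 2"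

definition power_diff_integral :: "real \<Rightarrow> real \<Rightarrow> real \<Rightarrow> real" where
  "power_diff_integral s g b = (LINT t:{0<..}|lebesgue. power_diff g b t / t powr (1 + 2 * s))"

lemma power_diff_minus: "power_diff g (- b) t = power_diff g b t"
  by (simp add: power_diff_def)

lemma power_diff_abs: "power_diff g \<bar>b\<bar> t = power_diff g b t"
  by (cases "0 \<le> b") (simp_all add: power_diff_minus)

lemma square_plus_gt: "t \<noteq> 1 \<Longrightarrow> 2 * t < 1 + t\<^sup>2" for t :: real
  using zero_less_power2[of "t - 1"] by (simp add: power2_eq_square algebra_simps)

text \<open>For \<bar>b\<bar> = 1 the line meets the origin at t = 1, where powr has its default
  value 0 and the comparisons below may fail. Hence t = 1 is excluded here and the integral
  estimates hold almost everywhere.\<close>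

lemma quadratic_pos:
  fixes b t :: real
  assumes "\<bar>b\<bar> \<le> 1" "0 < t" "t \<noteq> 1"
  shows "0 < 1 + t\<^sup>2 + 2 * b * t"
proof -
  have "(- b) * t \<le> 1 * t" using assms by (intro mult_right_mono) auto
  then show ?thesis using square_plus_gt[OF assms(3)] by simp
qed

text \<open>The chord inequality with A = 1 + t^2, Y = 2 t and c = \<bar>b\<bar>. It needs a
  positive exponent, so g = 0 is treated apart.\<close>

lemma power_diff_quadratic_bound:
  assumes g: "0 \<le> g" and b: "\<bar>b\<bar> \<le> 1" and t: "0 < t" "t \<noteq> 1"
  shows "power_diff g b t \<le> (1 - b\<^sup>2) * power_diff g 0 t + b\<^sup>2 * power_diff g 1 t"
proof (cases "g = 0")
  case True
  have "0 < 1 + t\<^sup>2 + 2 * b * t" "0 < 1 + t\<^sup>2 - 2 * b * t"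
    using quadratic_pos[OF b t] quadratic_pos[of "- b" t] b t by auto
  moreover have "0 < 1 + t\<^sup>2" "0 < 1 + t\<^sup>2 + 2 * t" "0 < 1 + t\<^sup>2 - 2 * t"
    using square_plus_gt[OF t(2)] t by (auto intro: add_pos_nonneg)
  ultimately show ?thesis using True by (simp add: power_diff_def)
next
  case False
  then have "0 < g / 2" using g by simp
  from reciprocal_pair_chord[OF _ square_plus_gt[OF t(2)] this abs_ge_zero b] t
  show ?thesis
    by (subst power_diff_abs[symmetric]) (simp add: power_diff_def algebra_simps)
qed

lemma power_diff_0_le:
  assumes g: "0 \<le> g" and b: "\<bar>b\<bar> \<le> 1" and t: "0 < t" "t \<noteq> 1"
  shows "power_diff g 0 t \<le> power_diff g b t"
proof (cases "g = 0")
  case True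
  have "0 < 1 + t\<^sup>2 + 2 * b * t" "0 < 1 + t\<^sup>2 - 2 * b * t"
    using quadratic_pos[OF b t] quadratic_pos[of "- b" t] b t by auto
  moreover have "0 < 1 + t\<^sup>2" by (auto intro: add_pos_nonneg)
  ultimately show ?thesis using True by (simp add: power_diff_def)
next
  case False
  then have e: "0 < g / 2" using g by simp
  have bt: "2 * \<bar>b\<bar> * t \<le> 2 * t" using b t by simp
  have "(1 + t\<^sup>2 + 0) powr (- (g / 2)) + (1 + t\<^sup>2 - 0) powr (- (g / 2))
    \<le> (1 + t\<^sup>2 + 2 * \<bar>b\<bar> * t) powr (- (g / 2)) + (1 + t\<^sup>2 - 2 * \<bar>b\<bar> * t) powr (- (g / 2))"
    using reciprocal_pair_mono[of 0 "2 * \<bar>b\<bar> * t" "1 + t\<^sup>2" "g / 2"] e t bt square_plus_gt[OF t(2)] by auto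
  then show ?thesis
    by (subst power_diff_abs[symmetric, of g b]) (simp add: power_diff_def)
qed

lemma power_diff_0_bounds:
  assumes g: "0 \<le> g" "g \<le> 1"
  shows "- min (2 * t\<^sup>2) 2 \<le> power_diff g 0 t" "power_diff g 0 t \<le> 0"
proof -
  have t1: "1 \<le> 1 + t\<^sup>2" by simp
  have "(1 + t\<^sup>2) powr (- g / 2) \<le> (1 + t\<^sup>2) powr 0" using g t1 by (intro powr_mono) auto
  then show "power_diff g 0 t \<le> 0" using t1 by (simp add: power_diff_def)
  have "(1 - t\<^sup>2) * (1 + t\<^sup>2) = 1 - (t\<^sup>2)\<^sup>2" by (simp add: algebra_simps power2_eq_square)
  then have "(1 - t\<^sup>2) * (1 + t\<^sup>2) \<le> 1" by simp
  then have "1 - t\<^sup>2 \<le> 1 / (1 + t\<^sup>2)" using t1 pos_le_divide_eq[of "1 + t\<^sup>2" "1 - t\<^sup>2" 1] by linarith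
  also have "\<dots> = (1 + t\<^sup>2) powr (- 1)" using t1 by (simp add: powr_minus_divide)
  also have "\<dots> \<le> (1 + t\<^sup>2) powr (- g / 2)" using g t1 by (intro powr_mono) auto
  finally have "- (2 * t\<^sup>2) \<le> power_diff g 0 t" by (simp add: power_diff_def)
  moreover have "- 2 \<le> power_diff g 0 t" by (simp add: power_diff_def)
  ultimately show "- min (2 * t\<^sup>2) 2 \<le> power_diff g 0 t" by simp
qed

lemma power_diff_1:
  assumes t: "0 < t"
  shows "power_diff g 1 t = (1 + t) powr (- g) + \<bar>1 - t\<bar> powr (- g) - 2"
proof -
  have "(x\<^sup>2) powr (- g / 2) = x powr (- g)" if "0 \<le> x" for x :: real
    using that by (cases "x = 0") (simp_all add: powr_powr flip: powr_numeral)
  from this[of "1 + t"] this[of "\<bar>1 - t\<bar>"] show ?thesis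
    using t by (simp add: power_diff_def power2_eq_square algebra_simps)
qed

section \<open>Integrability at zero, at the singularity and at infinity\<close>

lemma powr_le_chord:
  fixes a g :: real
  assumes "0 < a" "0 \<le> g" "g \<le> 1"
  shows "a powr (- g) \<le> (1 - g) + g / a"
proof -
  have "exp ((1 - g) *\<^sub>R 0 + g *\<^sub>R (- ln a)) \<le> (1 - g) * exp 0 + g * exp (- ln a)"
    using convex_onD[OF exp_convex, of g 0 "- ln a"] assms by auto
  then show ?thesis using assms by (simp add: powr_def exp_minus divide_inverse)
qed

text \<open>Near 0 convexity in the exponent reduces to g = 1, where the second difference is the
  rational function 2 t^2 / (1 - t^2). Around t = 1 the singular power is kept; beyond 2 both powers
  are at most 1.\<close>

lemma power_diff_1_upper:
  assumes g: "0 \<le> g" "g < 1" and t: "0 < t" "t \<noteq> 1"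
  shows "power_diff g 1 t \<le> 2 * min (2 * t\<^sup>2) 2 + indicator {1/2..<2} t * \<bar>1 - t\<bar> powr (- g)"
proof -
  have p1: "(1 + t) powr (- g) \<le> 1" using t g powr_mono[of "- g" 0 "1 + t"] by simp
  consider "t < 1 / 2" | "1 / 2 \<le> t" "t < 2" | "2 \<le> t" by linarith
  then show ?thesis
  proof cases
    case 1
    have t2: "t\<^sup>2 \<le> 1 / 4" using 1 t power_mono[of t "1/2" 2] by (simp add: power2_eq_square)
    have "power_diff g 1 t \<le> (1 - g) + g / (1 + t) + ((1 - g) + g / (1 - t)) - 2"
      using powr_le_chord[of "1 + t" g] powr_le_chord[of "1 - t" g] 1 t g by (simp add: power_diff_1)
    also have "\<dots> = g * (2 * t\<^sup>2 / (1 - t\<^sup>2))"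
      using 1 t t2 by (simp add: field_simps power2_eq_square)
    also have "\<dots> \<le> 1 * (2 * t\<^sup>2 / (1 - t\<^sup>2))"
      using g t2 by (intro mult_right_mono) auto
    also have "\<dots> \<le> 2 * t\<^sup>2 / (1 / 2)"
      unfolding mult_1 using t2 by (intro divide_left_mono mult_pos_pos) (linarith | simp)+
    also have "\<dots> = 2 * min (2 * t\<^sup>2) 2" using t2 by simp
    also have "\<dots> \<le> 2 * min (2 * t\<^sup>2) 2 + indicator {1/2..<2} t * \<bar>1 - t\<bar> powr (- g)" by simp
    finally show ?thesis .
  next
    case 2
    then show ?thesis using p1 t by (simp add: power_diff_1)
      (smt (verit) zero_le_power2)
  next
    case 3
    have "1 \<le> t\<^sup>2" using 3 by (simp add: one_le_power)
    moreover have "\<bar>1 - t\<bar> powr (- g) \<le> 1" using 3 g powr_mono[of "- g" 0 "\<bar>1 - t\<bar>"] by simp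
    ultimately show ?thesis using p1 t 3 by (simp add: power_diff_1)
  qed
qed

lemma power_diff_bound:
  assumes g: "0 \<le> g" "g < 1" and b: "\<bar>b\<bar> \<le> 1" and t: "0 < t" "t \<noteq> 1"
  shows "\<bar>power_diff g b t\<bar> \<le> 2 * min (2 * t\<^sup>2) 2 + indicator {1/2..<2} t * \<bar>1 - t\<bar> powr (- g)"
proof -
  have b2: "b\<^sup>2 \<le> 1" using b by (simp add: abs_square_le_1)
  have "power_diff g b t \<le> (1 - b\<^sup>2) * power_diff g 0 t + b\<^sup>2 * power_diff g 1 t"
    using power_diff_quadratic_bound[OF g(1) b t] .
  also have "\<dots> \<le> (1 - b\<^sup>2) * power_diff g 1 t + b\<^sup>2 * power_diff g 1 t"
    using power_diff_0_le[OF g(1) _ t, of 1] b2 by (intro add_mono mult_left_mono) auto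
  also have "\<dots> = power_diff g 1 t" by (simp add: algebra_simps)
  also note power_diff_1_upper[OF g t]
  finally have 1: "power_diff g b t \<le> 2 * min (2 * t\<^sup>2) 2 + indicator {1/2..<2} t * \<bar>1 - t\<bar> powr (- g)" .
  have "- min (2 * t\<^sup>2) 2 \<le> power_diff g b t"
    using power_diff_0_bounds(1)[of g t] power_diff_0_le[OF g(1) b t] g by linarith
  moreover have "0 \<le> min (2 * t\<^sup>2) 2" "0 \<le> indicator {1/2..<2} t * \<bar>1 - t\<bar> powr (- g)" by simp_all
  ultimately show ?thesis using 1 by linarith
qed

text \<open>The value 1 / (1 - g) of the last integral is what drives the radial coefficient to
  infinity as g tends to 1.\<close>

lemma integrable_powr_dist_1:
  fixes g :: real
  assumes "g < 1"
  shows "integrable lborel (\<lambda>t. indicator {0<..<2} t * \<bar>1 - t\<bar> powr (- g))"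
    and "integrable lborel (\<lambda>t. indicator {1<..<2} t * \<bar>1 - t\<bar> powr (- g))"
    and "(\<integral>t. indicator {1<..<2} t * \<bar>1 - t\<bar> powr (- g) \<partial>lborel) = 1 / (1 - g)"
proof -
  define f where "f = (\<lambda>t::real. indicator {0<..<1} t * t powr (- g))"
  have fm: "f \<in> borel_measurable lborel" unfolding f_def by simp
  have f1: "set_integrable lebesgue {0<..<1} (\<lambda>t. t powr (- g))"
    "(LINT t:{0<..<1}|lebesgue. t powr (- g)) = 1 / (1 - g)"
    using set_integrable_powr_0[of 1 "- g"] assms by auto
  have f: "integrable lborel f"
    using f1(1) integrable_completion[OF fm] by (simp add: set_integrable_def f_def)
  have fi: "integral\<^sup>L lborel f = 1 / (1 - g)"
    using f1(2) integral_completion[OF fm] by (simp add: set_lebesgue_integral_def f_def)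
  have i1: "integrable lborel (\<lambda>t. f (1 + (- 1) * t))"
    by (rule lborel_integrable_real_affine[OF f]) simp
  have i2: "integrable lborel (\<lambda>t. f (- 1 + 1 * t))"
    by (rule lborel_integrable_real_affine[OF f]) simp
  have e2: "(\<lambda>t. f (- 1 + 1 * t)) = (\<lambda>t. indicator {1<..<2} t * \<bar>1 - t\<bar> powr (- g))"
    by (auto simp: f_def fun_eq_iff indicator_def)
  have e12: "(\<lambda>t. f (1 + (- 1) * t) + f (- 1 + 1 * t)) = (\<lambda>t. indicator {0<..<2} t * \<bar>1 - t\<bar> powr (- g))"
    by (auto simp: f_def fun_eq_iff indicator_def)
  show "integrable lborel (\<lambda>t. indicator {0<..<2} t * \<bar>1 - t\<bar> powr (- g))"
    using Bochner_Integration.integrable_add[OF i1 i2] unfolding e12 .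
  show "integrable lborel (\<lambda>t. indicator {1<..<2} t * \<bar>1 - t\<bar> powr (- g))"
    using i2 unfolding e2 .
  show "(\<integral>t. indicator {1<..<2} t * \<bar>1 - t\<bar> powr (- g) \<partial>lborel) = 1 / (1 - g)"
    using lborel_integral_real_affine[of 1 f "- 1"] fi unfolding e2[symmetric] by simp
qed

lemma AE_lebesgue_neq: "AE t in lebesgue. t \<noteq> (c::real)"
  using AE_completion[OF AE_lborel_singleton[of c]] by simp

lemma power_diff_borel[measurable]: "power_diff g b \<in> borel_measurable borel"
  unfolding power_diff_def by measurable

lemma set_integrable_power_diff:
  assumes s: "0 < s" "s < 1" and g: "0 \<le> g" "g < 1" and b: "\<bar>b\<bar> \<le> 1"
  shows "set_integrable lebesgue {0<..} (\<lambda>t. power_diff g b t / t powr (1 + 2 * s))"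
proof -
  let ?k = "\<lambda>t. min (2 * (t / 1)\<^sup>2) 2 / t powr (1 + 2 * s)"
  let ?n = "\<lambda>t. indicator {0<..<2} t * \<bar>1 - t\<bar> powr (- g)"
  have near: "set_integrable lebesgue {0<..} (\<lambda>t. 8 * ?n t)"
  proof -
    have "integrable lebesgue (\<lambda>t. 8 * ?n t)"
      using integrable_powr_dist_1(1)[OF g(2)] by (subst integrable_completion) auto
    then show ?thesis unfolding set_integrable_def by (rule integrable_mult_indicator[rotated]) simp
  qed
  have G: "set_integrable lebesgue {0<..} (\<lambda>t. 2 * ?k t + 8 * ?n t)"
    using truncated_square_kernel(1)[OF s, of 1] near
    by (intro set_integral_add set_integrable_mult_right) auto
  show ?thesis
  proof (rule set_integrable_bound[OF G])
    show "set_borel_measurable lebesgue {0<..} (\<lambda>t. power_diff g b t / t powr (1 + 2 * s))"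
      unfolding set_borel_measurable_def by (rule measurable_completion) measurable
    show "AE t in lebesgue. t \<in> {0<..} \<longrightarrow>
        norm (power_diff g b t / t powr (1 + 2 * s)) \<le> norm (2 * ?k t + 8 * ?n t)"
      using AE_lebesgue_neq[of 1]
    proof eventually_elim
      case (elim t)
      show ?case
      proof
        assume "t \<in> {0<..}"
        then have t: "0 < t" by simp
        let ?i = "indicator {1/2..<2} t * \<bar>1 - t\<bar> powr (- g)"
        have "\<bar>power_diff g b t / t powr (1 + 2 * s)\<bar> \<le> (2 * min (2 * t\<^sup>2) 2 + ?i) / t powr (1 + 2 * s)"
          using power_diff_bound[OF g b t elim] by (simp add: divide_right_mono)
        also have "\<dots> = 2 * ?k t + ?i / t powr (1 + 2 * s)" by (simp add: add_divide_distrib)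
        also have "?i / t powr (1 + 2 * s) \<le> 8 * ?n t"
        proof (cases "t \<in> {1/2..<2}")
          case True
          have "1 / t powr (1 + 2 * s) = (1 / t) powr (1 + 2 * s)" using t by (simp add: powr_divide)
          also have "\<dots> \<le> 2 powr (1 + 2 * s)"
            using True t s by (intro powr_mono2) (auto simp: divide_le_eq)
          also have "\<dots> \<le> 2 powr 3" using s by (intro powr_mono) auto
          also have "\<dots> = 8" by (simp add: powr_numeral)
          finally have "\<bar>1 - t\<bar> powr (- g) * (1 / t powr (1 + 2 * s)) \<le> \<bar>1 - t\<bar> powr (- g) * 8"
            by (rule mult_left_mono) simp
          then show ?thesis using True by simp
        qed (auto simp: indicator_def)
        also have "2 * ?k t + 8 * ?n t = norm (2 * ?k t + 8 * ?n t)" by simp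
        finally show "norm (power_diff g b t / t powr (1 + 2 * s)) \<le> norm (2 * ?k t + 8 * ?n t)"
          by simp
      qed
    qed
  qed
qed

section \<open>The operator on radial powers\<close>

lemma set_integral_lincomb:
  fixes f h :: "'a \<Rightarrow> real"
  assumes "set_integrable M S f" "set_integrable M S h"
  shows "set_integrable M S (\<lambda>t. a * f t + b * h t)"
    and "(LINT t:S|M. a * f t + b * h t) = a * (LINT t:S|M. f t) + b * (LINT t:S|M. h t)"
  using assms set_integral_add[OF set_integrable_mult_right[of a, OF assms(1)] set_integrable_mult_right[of b, OF assms(2)]]
  by (simp_all add: set_integral_mult_right)

lemma norm_add_scaled:
  fixes x \<xi> :: "'a::euclidean_space"
  assumes x: "x \<noteq> 0" and \<xi>: "norm \<xi> = 1"
  shows "norm (x + (norm x * t) *\<^sub>R \<xi>) powr (- g)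
    = norm x powr (- g) * (1 + t\<^sup>2 + 2 * ((x \<bullet> \<xi>) / norm x) * t) powr (- g / 2)"
proof -
  have "(norm (x + (norm x * t) *\<^sub>R \<xi>))\<^sup>2 = (norm x)\<^sup>2 * (1 + t\<^sup>2 + 2 * ((x \<bullet> \<xi>) / norm x) * t)"
  proof -
    have "\<xi> \<bullet> \<xi> = 1" using \<xi> by (simp add: norm_eq_1)
    then have "(norm (x + (norm x * t) *\<^sub>R \<xi>))\<^sup>2 = x \<bullet> x + 2 * (norm x * t) * (x \<bullet> \<xi>) + (norm x * t)\<^sup>2"
      unfolding power2_norm_eq_inner by (simp add: inner_add inner_commute algebra_simps power2_eq_square)
    moreover have "x \<bullet> \<xi> = norm x * ((x \<bullet> \<xi>) / norm x)" using x by simp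
    ultimately show ?thesis
      by (simp add: power2_norm_eq_inner[symmetric] algebra_simps power2_eq_square)
  qed
  then have "((norm (x + (norm x * t) *\<^sub>R \<xi>))\<^sup>2) powr (- g / 2)
      = ((norm x)\<^sup>2) powr (- g / 2) * (1 + t\<^sup>2 + 2 * ((x \<bullet> \<xi>) / norm x) * t) powr (- g / 2)"
    by (simp add: powr_mult)
  moreover have "(y\<^sup>2) powr (- g / 2) = y powr (- g)" if "0 \<le> y" for y :: real
    using that by (cases "y = 0") (simp_all add: powr_powr flip: powr_numeral)
  ultimately show ?thesis by simp
qed

text \<open>By homogeneity lengths may be measured in units of norm x, which makes x a unit vector.
  The linear substitution is made over \<open>lborel\<close>, to which the integrals pass because
  both integrands are Borel.\<close>

lemma frac_dir_power:
  fixes x \<xi> :: "'a::euclidean_space"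
  assumes x: "x \<noteq> 0" and \<xi>: "norm \<xi> = 1"
  shows "frac_dir C s \<xi> (\<lambda>y. norm y powr (- g)) x
    = C s * norm x powr (- g - 2 * s) * power_diff_integral s g ((x \<bullet> \<xi>) / norm x)"
proof -
  define r where "r = norm x"
  define b where "b = (x \<bullet> \<xi>) / r"
  have r: "0 < r" using x by (simp add: r_def)
  define F where "F = (\<lambda>t. indicator {0<..} t *\<^sub>R ((norm (x + t *\<^sub>R \<xi>) powr (- g) + norm (x - t *\<^sub>R \<xi>) powr (- g)
      - 2 * norm x powr (- g)) / t powr (1 + 2 * s)))"
  define G where "G = (\<lambda>t. indicator {0<..} t *\<^sub>R (power_diff g b t / t powr (1 + 2 * s)))"
  have Fm: "F \<in> borel_measurable lborel"
  proof -
    have [measurable]: "(\<lambda>t. norm (x + t *\<^sub>R \<xi>)) \<in> borel_measurable borel"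
      "(\<lambda>t. norm (x - t *\<^sub>R \<xi>)) \<in> borel_measurable borel"
      by (intro borel_measurable_continuous_onI continuous_intros)+
    show ?thesis unfolding F_def by measurable
  qed
  have Gm: "G \<in> borel_measurable lborel" unfolding G_def by measurable
  have eq: "F (0 + r * t) = r powr (- g - 2 * s - 1) * G t" for t
  proof (cases "0 < t")
    case True
    have p: "norm (x + (r * t) *\<^sub>R \<xi>) powr (- g) = r powr (- g) * (1 + t\<^sup>2 + 2 * b * t) powr (- g / 2)"
      using norm_add_scaled[OF x \<xi>, of t g] by (simp add: r_def b_def)
    have m: "norm (x - (r * t) *\<^sub>R \<xi>) powr (- g) = r powr (- g) * (1 + t\<^sup>2 - 2 * b * t) powr (- g / 2)"
      using norm_add_scaled[OF x, of "- \<xi>" t g] \<xi> by (simp add: r_def b_def)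
    have "r powr (- g - 2 * s - 1) = r powr (- g) / r powr (1 + 2 * s)"
      using powr_diff[of r "- g" "1 + 2 * s"] by (simp add: algebra_simps)
    then have "r powr (- g - 2 * s - 1) * G t = r powr (- g) * power_diff g b t / (r powr (1 + 2 * s) * t powr (1 + 2 * s))"
      using True by (simp add: G_def)
    moreover have "F (0 + r * t) = r powr (- g) * power_diff g b t / (r * t) powr (1 + 2 * s)"
      using True r p m by (simp add: F_def power_diff_def algebra_simps flip: r_def)
    ultimately show ?thesis by (simp only: powr_mult)
  next
    case False
    then show ?thesis using r by (simp add: F_def G_def zero_less_mult_iff)
  qed
  have "(LINT t|lebesgue. F t) = (LINT t|lborel. F t)" by (rule integral_completion[OF Fm])
  also have "\<dots> = \<bar>r\<bar> *\<^sub>R (LINT t|lborel. F (0 + r * t))"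
    using r by (intro lborel_integral_real_affine) simp
  also have "\<dots> = r * (r powr (- g - 2 * s - 1) * (LINT t|lborel. G t))"
    unfolding eq using r by simp
  also have "r * (r powr (- g - 2 * s - 1) * (LINT t|lborel. G t)) = r powr (- g - 2 * s) * (LINT t|lborel. G t)"
    using r powr_diff[of r "- g - 2 * s" 1] by simp
  also have "(LINT t|lborel. G t) = (LINT t|lebesgue. G t)" by (rule integral_completion[OF Gm, symmetric])
  finally show ?thesis
    unfolding frac_dir_def power_diff_integral_def set_lebesgue_integral_def
    by (simp add: F_def G_def r_def b_def)
qed

lemma bessel_inequality:
  fixes x :: "'a::euclidean_space"
  assumes "B \<in> orthonormal_families k"
  shows "(\<Sum>\<xi>\<in>B. (x \<bullet> \<xi>)\<^sup>2) \<le> (norm x)\<^sup>2"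
proof -
  have fin: "finite B" and orth: "pairwise orthogonal B" and one: "\<And>\<xi>. \<xi> \<in> B \<Longrightarrow> norm \<xi> = 1"
    using assms by (auto simp: orthonormal_families_def)
  define p where "p = (\<Sum>\<xi>\<in>B. (x \<bullet> \<xi>) *\<^sub>R \<xi>)"
  have p\<xi>: "p \<bullet> \<xi> = x \<bullet> \<xi>" if \<xi>: "\<xi> \<in> B" for \<xi>
  proof -
    have "p \<bullet> \<xi> = (\<Sum>\<eta>\<in>B. if \<eta> = \<xi> then x \<bullet> \<xi> else 0)"
      unfolding p_def inner_sum_left
      using orth one \<xi> by (intro sum.cong refl) (auto simp: pairwise_def orthogonal_def norm_eq_1)
    then show ?thesis using fin \<xi> by simp
  qed
  have xp: "x \<bullet> p = (\<Sum>\<xi>\<in>B. (x \<bullet> \<xi>)\<^sup>2)"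
    by (simp add: p_def inner_sum_right power2_eq_square)
  have pp: "p \<bullet> p = (\<Sum>\<xi>\<in>B. (x \<bullet> \<xi>)\<^sup>2)"
  proof -
    have "p \<bullet> p = (\<Sum>\<xi>\<in>B. (x \<bullet> \<xi>) * (p \<bullet> \<xi>))"
      by (subst (2) p_def) (simp add: inner_sum_right)
    then show ?thesis using p\<xi> by (simp add: power2_eq_square)
  qed
  have "0 \<le> (x - p) \<bullet> (x - p)" by simp
  also have "\<dots> = (norm x)\<^sup>2 - (\<Sum>\<xi>\<in>B. (x \<bullet> \<xi>)\<^sup>2)"
    using xp pp by (simp add: inner_diff inner_commute power2_norm_eq_inner)
  finally show ?thesis by simp
qed

lemma power_diff_integral_quadratic_bound:
  assumes s: "0 < s" "s < 1" and g: "0 \<le> g" "g < 1" and b: "\<bar>b\<bar> \<le> 1"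
  shows "power_diff_integral s g b
    \<le> power_diff_integral s g 0 + b\<^sup>2 * (power_diff_integral s g 1 - power_diff_integral s g 0)"
proof -
  note int = set_integrable_power_diff[OF s g]
  let ?q = "\<lambda>b t. power_diff g b t / t powr (1 + 2 * s)"
  have q01: "set_integrable lebesgue {0<..} (?q 0)" "set_integrable lebesgue {0<..} (?q 1)"
    by (auto intro!: int)
  note lin = set_integral_lincomb[OF q01, of "1 - b\<^sup>2" "b\<^sup>2"]
  have "power_diff_integral s g b \<le> (LINT t:{0<..}|lebesgue. (1 - b\<^sup>2) * ?q 0 t + b\<^sup>2 * ?q 1 t)"
    unfolding power_diff_integral_def
  proof (rule set_integral_mono_AE)
    show "AE t\<in>{0<..} in lebesgue. ?q b t \<le> (1 - b\<^sup>2) * ?q 0 t + b\<^sup>2 * ?q 1 t"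
      using AE_lebesgue_neq[of 1]
    proof eventually_elim
      case (elim t)
      show ?case
      proof
        assume "t \<in> {0<..}"
        then have "?q b t \<le> ((1 - b\<^sup>2) * power_diff g 0 t + b\<^sup>2 * power_diff g 1 t) / t powr (1 + 2 * s)"
          using power_diff_quadratic_bound[OF g(1) b _ elim] by (intro divide_right_mono) auto
        then show "?q b t \<le> (1 - b\<^sup>2) * ?q 0 t + b\<^sup>2 * ?q 1 t" by (simp add: add_divide_distrib)
      qed
    qed
  qed (fact int[OF b] lin(1))+
  also have "\<dots> = (1 - b\<^sup>2) * power_diff_integral s g 0 + b\<^sup>2 * power_diff_integral s g 1"
    unfolding power_diff_integral_def
    by (rule lin(2))
  finally show ?thesis by (simp add: algebra_simps)
qed

lemma power_diff_integral_0_le_1: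
  assumes s: "0 < s" "s < 1" and g: "0 \<le> g" "g < 1"
  shows "power_diff_integral s g 0 \<le> power_diff_integral s g 1"
  unfolding power_diff_integral_def
proof (rule set_integral_mono_AE)
  show "AE t\<in>{0<..} in lebesgue. power_diff g 0 t / t powr (1 + 2 * s) \<le> power_diff g 1 t / t powr (1 + 2 * s)"
    using AE_lebesgue_neq[of 1]
    by eventually_elim (use power_diff_0_le[OF g(1), of 1] in \<open>auto intro!: divide_right_mono\<close>)
qed (use set_integrable_power_diff[OF s g] in auto)

text \<open>Up to the factor C s this is the coefficient c_k(g): cosine 1 for the radial direction,
  cosine 0 for the k - 1 directions orthogonal to it.\<close>

definition radial_coeff :: "real \<Rightarrow> nat \<Rightarrow> real \<Rightarrow> real" where
  "radial_coeff s k g = power_diff_integral s g 1 + (real k - 1) * power_diff_integral s g 0"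

text \<open>Each direction contributes at most an affine function of its squared cosine, with
  nonnegative slope, and by Bessel the squared cosines of a frame add up to at most 1. A frame
  containing the radial direction attains the resulting bound, so the supremum is a maximum.\<close>

lemma frac_plus_power:
  fixes x :: "'a::euclidean_space"
  assumes s: "0 < s" "s < 1" and g: "0 \<le> g" "g < 1" and C: "0 < C s"
    and k: "1 \<le> k" "k \<le> DIM('a)" and x: "x \<noteq> 0"
  shows "frac_plus C s k (\<lambda>y. norm y powr (- g)) x = C s * norm x powr (- g - 2 * s) * radial_coeff s k g"
  unfolding frac_plus_def
proof (rule cSup_eq_maximum)
  let ?P = "C s * norm x powr (- g - 2 * s)" and ?J = "power_diff_integral s g"
  let ?b = "\<lambda>\<xi>. (x \<bullet> \<xi>) / norm x"
  have sum_eq: "(\<Sum>\<xi>\<in>B. frac_dir C s \<xi> (\<lambda>y. norm y powr (- g)) x) = ?P * (\<Sum>\<xi>\<in>B. ?J (?b \<xi>))"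
    if "B \<in> orthonormal_families k" for B
    unfolding sum_distrib_left using that frac_dir_power[OF x]
    by (intro sum.cong) (auto simp: orthonormal_families_def)
  have P: "0 \<le> ?P" using C by simp
  show "?P * radial_coeff s k g
    \<in> (\<lambda>B. \<Sum>\<xi>\<in>B. frac_dir C s \<xi> (\<lambda>y. norm y powr (- g)) x) ` orthonormal_families k"
  proof -
    let ?e = "x /\<^sub>R norm x"
    have e: "norm ?e = 1" using x by simp
    obtain B where B: "B \<in> orthonormal_families k" "?e \<in> B"
      using orthonormal_family_containing[OF e k] by metis
    have fin: "finite B" "card B = k" using B by (auto simp: orthonormal_families_def)
    have b0: "?b \<xi> = 0" if "\<xi> \<in> B - {?e}" for \<xi>
    proof -
      have "pairwise orthogonal B" using B(1) by (simp add: orthonormal_families_def)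
      then have "orthogonal ?e \<xi>" by (rule pairwiseD) (use B(2) that in auto)
      then show ?thesis using x by (simp add: orthogonal_def)
    qed
    have "(\<Sum>\<xi>\<in>B - {?e}. ?J (?b \<xi>)) = (\<Sum>\<xi>\<in>B - {?e}. ?J 0)"
      by (rule sum.cong[OF refl]) (simp only: b0)
    also have "\<dots> = (real k - 1) * ?J 0" using B fin k by (simp add: of_nat_diff)
    finally have "(\<Sum>\<xi>\<in>B. ?J (?b \<xi>)) = ?J (?b ?e) + (real k - 1) * ?J 0"
      using sum.remove[OF fin(1) B(2), of "\<lambda>\<xi>. ?J (?b \<xi>)"] by simp
    moreover have "?b ?e = 1" using x by (simp add: power2_norm_eq_inner[symmetric] power2_eq_square)
    ultimately have "(\<Sum>\<xi>\<in>B. frac_dir C s \<xi> (\<lambda>y. norm y powr (- g)) x) = ?P * radial_coeff s k g"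
      using sum_eq[OF B(1)] by (simp only: radial_coeff_def)
    then show ?thesis using B(1) by (metis (no_types, lifting) image_eqI)
  qed
  fix y assume "y \<in> (\<lambda>B. \<Sum>\<xi>\<in>B. frac_dir C s \<xi> (\<lambda>y. norm y powr (- g)) x) ` orthonormal_families k"
  then obtain B where B: "B \<in> orthonormal_families k"
    and y: "y = (\<Sum>\<xi>\<in>B. frac_dir C s \<xi> (\<lambda>y. norm y powr (- g)) x)" by auto
  have "(\<Sum>\<xi>\<in>B. ?J (?b \<xi>)) \<le> (\<Sum>\<xi>\<in>B. ?J 0 + (?b \<xi>)\<^sup>2 * (?J 1 - ?J 0))"
  proof (rule sum_mono)
    fix \<xi> assume "\<xi> \<in> B"
    then have "norm \<xi> = 1" using B by (auto simp: orthonormal_families_def)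
    then have "\<bar>?b \<xi>\<bar> \<le> 1" using Cauchy_Schwarz_ineq2[of x \<xi>] x by simp
    then show "?J (?b \<xi>) \<le> ?J 0 + (?b \<xi>)\<^sup>2 * (?J 1 - ?J 0)"
      by (rule power_diff_integral_quadratic_bound[OF s g])
  qed
  also have "\<dots> = k * ?J 0 + (\<Sum>\<xi>\<in>B. (?b \<xi>)\<^sup>2) * (?J 1 - ?J 0)"
    using B by (simp add: sum.distrib sum_distrib_right orthonormal_families_def)
  also have "\<dots> \<le> k * ?J 0 + 1 * (?J 1 - ?J 0)"
  proof -
    have "(\<Sum>\<xi>\<in>B. (?b \<xi>)\<^sup>2) = (\<Sum>\<xi>\<in>B. (x \<bullet> \<xi>)\<^sup>2) / (norm x)\<^sup>2"
      by (simp add: power_divide sum_divide_distrib)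
    also have "\<dots> \<le> 1" using bessel_inequality[OF B, of x] x by simp
    finally have "(\<Sum>\<xi>\<in>B. (?b \<xi>)\<^sup>2) * (?J 1 - ?J 0) \<le> 1 * (?J 1 - ?J 0)"
      using power_diff_integral_0_le_1[OF s g] by (intro mult_right_mono) simp_all
    then show ?thesis by simp
  qed
  also have "\<dots> = radial_coeff s k g" by (simp add: radial_coeff_def algebra_simps)
  finally show "y \<le> ?P * radial_coeff s k g"
    unfolding y sum_eq[OF B] by (rule mult_left_mono[OF _ P])
qed

section \<open>Convexity of the radial coefficient and its behaviour at 0 and 1\<close>

lemma power_convex_in_exponent:
  fixes a x y t :: real
  assumes "0 < a" "0 \<le> t" "t \<le> 1"
  shows "a powr (- ((1 - t) * x + t * y) / 2) \<le> (1 - t) * a powr (- x / 2) + t * a powr (- y / 2)"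
proof -
  have "exp ((1 - t) *\<^sub>R (- x / 2 * ln a) + t *\<^sub>R (- y / 2 * ln a))
      \<le> (1 - t) * exp (- x / 2 * ln a) + t * exp (- y / 2 * ln a)"
    by (rule convex_onD[OF exp_convex]) (use assms in auto)
  moreover have "(1 - t) *\<^sub>R (- x / 2 * ln a) + t *\<^sub>R (- y / 2 * ln a) = - ((1 - t) * x + t * y) / 2 * ln a"
    by (simp add: algebra_simps add_divide_distrib diff_divide_distrib)
  ultimately show ?thesis using assms(1) by (simp only: powr_def if_False less_irrefl) simp
qed

lemma power_diff_convex:
  assumes b: "\<bar>b\<bar> \<le> 1" and r: "0 < r" "r \<noteq> 1" and t: "0 \<le> t" "t \<le> 1"
  shows "power_diff ((1 - t) * x + t * y) b r \<le> (1 - t) * power_diff x b r + t * power_diff y b r"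
  using power_convex_in_exponent[OF quadratic_pos[OF b r] t, of x y]
    power_convex_in_exponent[OF quadratic_pos[of "- b", OF _ r] t, of x y] b
  by (simp add: power_diff_def algebra_simps)

lemma convex_on_power_diff_integral:
  assumes s: "0 < s" "s < 1" and b: "\<bar>b\<bar> \<le> 1"
  shows "convex_on {0..<1} (\<lambda>g. power_diff_integral s g b)"
proof (rule convex_onI)
  fix t x y :: real assume t: "0 < t" "t < 1" and x: "x \<in> {0..<1}" and y: "y \<in> {0..<1}"
  note int = set_integrable_power_diff[OF s _ _ b]
  let ?q = "\<lambda>g r. power_diff g b r / r powr (1 + 2 * s)"
  let ?z = "(1 - t) * x + t * y"
  have z: "0 \<le> ?z" "?z < 1"
    using x y t convex_bound_lt[of x 1 y "1 - t" t] by auto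
  have qxy: "set_integrable lebesgue {0<..} (?q x)" "set_integrable lebesgue {0<..} (?q y)"
    using x y by (auto intro!: int)
  note lin = set_integral_lincomb[OF qxy, of "1 - t" t]
  have "power_diff_integral s ?z b \<le> (LINT r:{0<..}|lebesgue. (1 - t) * ?q x r + t * ?q y r)"
    unfolding power_diff_integral_def
  proof (rule set_integral_mono_AE)
    show "AE r\<in>{0<..} in lebesgue. ?q ?z r \<le> (1 - t) * ?q x r + t * ?q y r"
      using AE_lebesgue_neq[of 1]
    proof eventually_elim
      case (elim r)
      show ?case
      proof
        assume "r \<in> {0<..}"
        then have "?q ?z r \<le> ((1 - t) * power_diff x b r + t * power_diff y b r) / r powr (1 + 2 * s)"
          using power_diff_convex[OF b _ elim, of t x y] t by (intro divide_right_mono) auto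
        then show "?q ?z r \<le> (1 - t) * ?q x r + t * ?q y r" by (simp add: add_divide_distrib)
      qed
    qed
  qed (fact int[OF z] lin(1))+
  also have "\<dots> = (1 - t) * power_diff_integral s x b + t * power_diff_integral s y b"
    unfolding power_diff_integral_def
    by (rule lin(2))
  finally show "power_diff_integral s ((1 - t) *\<^sub>R x + t *\<^sub>R y) b
      \<le> (1 - t) * power_diff_integral s x b + t * power_diff_integral s y b" by simp
qed simp

lemma convex_on_radial_coeff:
  assumes "0 < s" "s < 1" "1 \<le> k"
  shows "convex_on {0..<1} (radial_coeff s k)"
  unfolding radial_coeff_def[abs_def] using assms
  by (intro convex_on_add convex_on_cmul convex_on_power_diff_integral) auto

lemma radial_coeff_0: "radial_coeff s k 0 = 0"
proof -
  have "power_diff_integral s 0 b = 0" if "\<bar>b\<bar> \<le> 1" for b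
    unfolding power_diff_integral_def set_lebesgue_integral_def
  proof (rule integral_eq_zero_AE)
    show "AE t in lebesgue. indicator {0<..} t *\<^sub>R (power_diff 0 b t / t powr (1 + 2 * s)) = 0"
      using AE_lebesgue_neq[of 1]
    proof eventually_elim
      case (elim t)
      then show ?case
        using quadratic_pos[OF that _ elim] quadratic_pos[of "- b" t] that
        by (auto simp: power_diff_def indicator_def)
    qed
  qed
  then show ?thesis by (simp add: radial_coeff_def)
qed

text \<open>The truncated kernel of radius 1 bounds everything but the singular power from below.
  That power is kept only on {1<..<2}, where t^(1+2s) is at most 2^3; hence the factor 1/8.\<close>

lemma power_diff_integral_lower:
  assumes s: "0 < s" "s < 1" and g: "0 \<le> g" "g < 1"
  shows "- (1 / s + 1 / (1 - s)) \<le> power_diff_integral s g 0"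
    and "1 / (8 * (1 - g)) - (1 / s + 1 / (1 - s)) \<le> power_diff_integral s g 1"
proof -
  note int = set_integrable_power_diff[OF s g]
  let ?k = "\<lambda>t. min (2 * (t / 1)\<^sup>2) 2 / t powr (1 + 2 * s)"
  have k: "set_integrable lebesgue {0<..} ?k" "(LINT t:{0<..}|lebesgue. ?k t) = 1 / s + 1 / (1 - s)"
    using truncated_square_kernel[OF s, of 1] by auto
  let ?n = "\<lambda>t. indicator {1<..<2} t * \<bar>1 - t\<bar> powr (- g)"
  have ne: "(\<lambda>t. indicator {0<..} t *\<^sub>R ?n t) = ?n" by (auto simp: fun_eq_iff indicator_def)
  have n: "set_integrable lebesgue {0<..} ?n" "(LINT t:{0<..}|lebesgue. ?n t) = 1 / (1 - g)"
    using integrable_powr_dist_1[OF g(2)]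
    unfolding set_integrable_def set_lebesgue_integral_def ne
    by (simp_all add: integrable_completion integral_completion)
  have "(LINT t:{0<..}|lebesgue. - 1 * ?k t) \<le> power_diff_integral s g 0"
    unfolding power_diff_integral_def
  proof (rule set_integral_mono)
    fix t :: real assume "t \<in> {0<..}"
    have "- min (2 * t\<^sup>2) 2 / t powr (1 + 2 * s) \<le> power_diff g 0 t / t powr (1 + 2 * s)"
      using power_diff_0_bounds(1)[of g t] g by (intro divide_right_mono) auto
    then show "- 1 * ?k t \<le> power_diff g 0 t / t powr (1 + 2 * s)" by simp
  qed ((rule set_integrable_mult_right, rule k(1)), (rule int, simp))
  then show "- (1 / s + 1 / (1 - s)) \<le> power_diff_integral s g 0"
    unfolding set_integral_mult_right k(2) by simp
  note lin = set_integral_lincomb[OF n(1) k(1), of "1 / 8" "- 1"]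
  have "(LINT t:{0<..}|lebesgue. (1 / 8) * ?n t + (- 1) * ?k t) \<le> power_diff_integral s g 1"
    unfolding power_diff_integral_def
  proof (rule set_integral_mono_AE)
    show "AE t\<in>{0<..} in lebesgue. (1 / 8) * ?n t + (- 1) * ?k t \<le> power_diff g 1 t / t powr (1 + 2 * s)"
      using AE_lebesgue_neq[of 1]
    proof eventually_elim
      case (elim t)
      show ?case
      proof
        assume "t \<in> {0<..}"
        then have t: "0 < t" by simp
        show "(1 / 8) * ?n t + (- 1) * ?k t \<le> power_diff g 1 t / t powr (1 + 2 * s)"
        proof (cases "t \<in> {1<..<2}")
          case True
          have "t powr (1 + 2 * s) \<le> 2 powr (1 + 2 * s)" using True s by (intro powr_mono2) auto
          also have "\<dots> \<le> 2 powr 3" using s by (intro powr_mono) auto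
          also have "\<dots> = 8" by (simp add: powr_numeral)
          finally have h1: "\<bar>1 - t\<bar> powr (- g) / 8 \<le> \<bar>1 - t\<bar> powr (- g) / t powr (1 + 2 * s)"
            using t by (intro divide_left_mono) auto
          have "1 \<le> t\<^sup>2" using True by (simp add: one_le_power)
          then have "\<bar>1 - t\<bar> powr (- g) - min (2 * t\<^sup>2) 2 \<le> power_diff g 1 t"
            using t by (simp add: power_diff_1)
          then have h2: "(\<bar>1 - t\<bar> powr (- g) - min (2 * t\<^sup>2) 2) / t powr (1 + 2 * s)
              \<le> power_diff g 1 t / t powr (1 + 2 * s)"
            by (intro divide_right_mono) auto
          have "(1 / 8) * ?n t + (- 1) * ?k t
              = \<bar>1 - t\<bar> powr (- g) / 8 - min (2 * t\<^sup>2) 2 / t powr (1 + 2 * s)"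
            using True by simp
          then show ?thesis using h1 h2 unfolding diff_divide_distrib by linarith
        next
          case False
          have "- min (2 * t\<^sup>2) 2 \<le> power_diff g 1 t"
            using power_diff_0_bounds(1)[of g t] power_diff_0_le[OF g(1) _ t elim, of 1] g by auto
          then have "- min (2 * t\<^sup>2) 2 / t powr (1 + 2 * s) \<le> power_diff g 1 t / t powr (1 + 2 * s)"
            by (intro divide_right_mono) auto
          then show ?thesis using False by simp
        qed
      qed
    qed
  qed (rule lin(1), (rule int, simp))
  moreover have "(LINT t:{0<..}|lebesgue. (1 / 8) * ?n t + (- 1) * ?k t)
      = (1 / 8) * (1 / (1 - g)) + (- 1) * (1 / s + 1 / (1 - s))"
    unfolding lin(2) k(2) n(2) ..
  ultimately show "1 / (8 * (1 - g)) - (1 / s + 1 / (1 - s)) \<le> power_diff_integral s g 1" by simp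
qed

lemma radial_coeff_pos_near_1:
  assumes s: "0 < s" "s < 1" and k: "1 \<le> k" and "g0 < 1"
  obtains g where "g0 < g" "0 < g" "g < 1" "0 < radial_coeff s k g"
proof -
  define K where "K = 1 / s + 1 / (1 - s)"
  have K: "0 < K" using s by (auto simp: K_def intro: add_pos_pos)
  define e where "e = 1 - max 0 g0"
  have e: "0 < e" using assms by (simp add: e_def)
  \<comment> \<open>With K from the previous bounds the coefficient at 1 - d is at least 1 / (8 d) -
    k K; the first entry makes this at least 1, the second keeps 1 - d above 0 and g0.\<close>
  define d where "d = min (1 / (8 * (k * K + 1))) (e / 2)"
  have "d \<le> e / 2" by (simp add: d_def)
  also have "e / 2 < e" using e by simp
  finally have "d < e" .
  then have d: "0 < d" "d < 1 - max 0 g0" "d \<le> 1 / (8 * (k * K + 1))"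
    using K e by (auto simp: d_def e_def[symmetric] intro!: add_nonneg_pos mult_nonneg_nonneg)
  define g where "g = 1 - d"
  have g: "g0 < g" "0 < g" "g < 1" using d by (auto simp: g_def)
  have "0 < k * K + 1" using K by (intro add_nonneg_pos) auto
  then have "k * K + 1 \<le> 1 / (8 * d)" using d by (simp add: field_simps)
  moreover have "1 / (8 * d) - K \<le> power_diff_integral s g 1" "- K \<le> power_diff_integral s g 0"
    using power_diff_integral_lower[OF s, of g] g by (auto simp: K_def g_def)
  moreover from this(2) have "(real k - 1) * (- K) \<le> (real k - 1) * power_diff_integral s g 0"
    using k by (intro mult_left_mono) auto
  moreover have "(real k - 1) * (- K) = K - k * K" by (simp add: algebra_simps)
  ultimately have "0 < radial_coeff s k g" unfolding radial_coeff_def by linarith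
  then show ?thesis using that g by blast
qed

section \<open>A logarithmic integral\<close>

lemma ln_abs_eq: "ln \<bar>x\<bar> = ln x" for x :: real
  by (simp add: abs_if ln_minus)

lemma DERIV_ln_nonzero:
  fixes x :: real
  assumes "x \<noteq> 0"
  shows "(ln has_real_derivative 1 / x) (at x)"
proof (cases "0 < x")
  case True
  then show ?thesis by (rule DERIV_ln_divide)
next
  case False
  then have "0 < - x" using assms by simp
  from DERIV_chain2[OF DERIV_ln_divide[OF this] DERIV_minus[OF DERIV_ident]]
  show ?thesis by (simp add: ln_minus)
qed

text \<open>Since \<open>ln x = ln \<bar>x\<bar>\<close> for negative \<open>x\<close>, the following is an antiderivative of
  \<open>ln \<bar>1 - x\<^sup>2\<bar> / x\<^sup>2\<close> on both sides of \<open>1\<close>.\<close>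

definition log_primitive :: "real \<Rightarrow> real" where
  "log_primitive x = - ((1 / x + 1) * ln (1 + x) + (1 / x - 1) * ln (1 - x))"

lemma log_primitive_deriv:
  assumes x: "0 < x" "x \<noteq> 1"
  shows "(log_primitive has_real_derivative ln (1 - x\<^sup>2) / x\<^sup>2) (at x)"
proof -
  have "((\<lambda>x. ln (1 + x)) has_real_derivative 1 / (1 + x) * (0 + 1)) (at x)"
    by (rule DERIV_chain2[OF DERIV_ln_nonzero]) (use x in \<open>auto intro!: derivative_eq_intros\<close>)
  then have 1: "((\<lambda>x. ln (1 + x)) has_real_derivative 1 / (1 + x)) (at x)" by simp
  have "((\<lambda>x. ln (1 - x)) has_real_derivative 1 / (1 - x) * (0 - 1)) (at x)"
    by (rule DERIV_chain2[OF DERIV_ln_nonzero]) (use x in \<open>auto intro!: derivative_eq_intros\<close>)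
  then have 2: "((\<lambda>x. ln (1 - x)) has_real_derivative - 1 / (1 - x)) (at x)" by simp
  have 3: "((\<lambda>x. 1 / x + 1) has_real_derivative - 1 / x\<^sup>2) (at x)"
    "((\<lambda>x. 1 / x - 1) has_real_derivative - 1 / x\<^sup>2) (at x)"
    using x by (auto intro!: derivative_eq_intros simp: power2_eq_square)
  have "((\<lambda>x. - ((1 / x + 1) * ln (1 + x) + (1 / x - 1) * ln (1 - x))) has_real_derivative
      - (((- 1 / x\<^sup>2) * ln (1 + x) + 1 / (1 + x) * (1 / x + 1))
        + ((- 1 / x\<^sup>2) * ln (1 - x) + (- 1 / (1 - x)) * (1 / x - 1)))) (at x)"
    by (intro DERIV_minus DERIV_add DERIV_mult 1 2 3)
  moreover have "1 / (1 + x) * (1 / x + 1) = 1 / x" "(- 1 / (1 - x)) * (1 / x - 1) = - 1 / x"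
    using x by (simp_all add: divide_simps)
  moreover have "ln (1 - x\<^sup>2) = ln (1 + x) + ln (1 - x)"
    using x ln_mult[of "1 + x" "1 - x"] by (simp add: power2_eq_square algebra_simps)
  ultimately show ?thesis
    unfolding log_primitive_def[abs_def] by (simp add: add_divide_distrib)
qed

text \<open>The one-sided limits at 1 agree, so the primitive passes through the logarithmic
  singularity without a jump, and both end limits vanish. This is why the integral below is
  zero.\<close>

lemma log_primitive_limits:
  "(log_primitive \<longlongrightarrow> 0) (at_right 0)" "(log_primitive \<longlongrightarrow> - 2 * ln 2) (at_left 1)"
  "(log_primitive \<longlongrightarrow> - 2 * ln 2) (at_right 1)" "(log_primitive \<longlongrightarrow> 0) at_top"
proof -
  have e: "log_primitive = (\<lambda>x. - ((1 / x + 1) * ln (1 + x) + (1 / x - 1) * ln (x - 1)))"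
    using ln_minus[of "x - 1" for x :: real] by (simp add: log_primitive_def fun_eq_iff)
  show "(log_primitive \<longlongrightarrow> 0) (at_right 0)" "(log_primitive \<longlongrightarrow> - 2 * ln 2) (at_left 1)"
    unfolding log_primitive_def[abs_def] by real_asymp+
  show "(log_primitive \<longlongrightarrow> - 2 * ln 2) (at_right 1)" "(log_primitive \<longlongrightarrow> 0) at_top"
    unfolding e by real_asymp+
qed

section \<open>Integrating across the logarithmic singularity\<close>

lemma set_integral_FTC_nonneg_Ioo:
  fixes f F :: "real \<Rightarrow> real" and a b :: real
  assumes "a < b"
    and "\<And>x. a < x \<Longrightarrow> x < b \<Longrightarrow> (F has_real_derivative f x) (at x)"
    and "\<And>x. a < x \<Longrightarrow> x < b \<Longrightarrow> isCont f x"
    and "\<And>x. a < x \<Longrightarrow> x < b \<Longrightarrow> 0 \<le> f x"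
    and "(F \<longlongrightarrow> A) (at_right a)" "(F \<longlongrightarrow> B) (at_left b)"
  shows "set_integrable lborel {a<..<b} f" "(LINT x:{a<..<b}|lborel. f x) = B - A"
proof -
  have e: "einterval (ereal a) (ereal b) = {a<..<b}" by (auto simp: einterval_def)
  have *: "ereal a < ereal b"
    "\<And>x. ereal a < ereal x \<Longrightarrow> ereal x < ereal b \<Longrightarrow> (F has_real_derivative f x) (at x)"
    "\<And>x. ereal a < ereal x \<Longrightarrow> ereal x < ereal b \<Longrightarrow> isCont f x"
    "AE x in lborel. ereal a < ereal x \<longrightarrow> ereal x < ereal b \<longrightarrow> 0 \<le> f x"
    "((F \<circ> real_of_ereal) \<longlongrightarrow> A) (at_right (ereal a))"
    "((F \<circ> real_of_ereal) \<longlongrightarrow> B) (at_left (ereal b))"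
    using assms by (simp_all add: ereal_tendsto_simps1)
  show "set_integrable lborel {a<..<b} f" using interval_integral_FTC_nonneg(1)[OF *] by (simp add: e)
  show "(LINT x:{a<..<b}|lborel. f x) = B - A"
    using interval_integral_FTC_nonneg(2)[OF *] assms(1) by (simp add: interval_lebesgue_integral_def e)
qed

lemma set_integral_FTC_nonneg_Ioi:
  fixes f F :: "real \<Rightarrow> real" and a :: real
  assumes "\<And>x. a < x \<Longrightarrow> (F has_real_derivative f x) (at x)"
    and "\<And>x. a < x \<Longrightarrow> isCont f x"
    and "\<And>x. a < x \<Longrightarrow> 0 \<le> f x"
    and "(F \<longlongrightarrow> A) (at_right a)" "(F \<longlongrightarrow> B) at_top"
  shows "set_integrable lborel {a<..} f" "(LINT x:{a<..}|lborel. f x) = B - A"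
proof -
  have e: "einterval (ereal a) \<infinity> = {a<..}" by (auto simp: einterval_def)
  have *: "ereal a < \<infinity>"
    "\<And>x. ereal a < ereal x \<Longrightarrow> ereal x < \<infinity> \<Longrightarrow> (F has_real_derivative f x) (at x)"
    "\<And>x. ereal a < ereal x \<Longrightarrow> ereal x < \<infinity> \<Longrightarrow> isCont f x"
    "AE x in lborel. ereal a < ereal x \<longrightarrow> ereal x < \<infinity> \<longrightarrow> 0 \<le> f x"
    "((F \<circ> real_of_ereal) \<longlongrightarrow> A) (at_right (ereal a))"
    "((F \<circ> real_of_ereal) \<longlongrightarrow> B) (at_left \<infinity>)"
    using assms by (simp_all add: ereal_tendsto_simps1)
  show "set_integrable lborel {a<..} f" using interval_integral_FTC_nonneg(1)[OF *] by (simp add: e)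
  show "(LINT x:{a<..}|lborel. f x) = B - A"
    using interval_integral_FTC_nonneg(2)[OF *] by (simp add: interval_lebesgue_integral_def e)
qed

text \<open>The substitution x = t^m in \<open>log_primitive\<close>: the inner derivative m *
  t^(m-1) turns 1 / t^(2m) into 1 / t^(m+1). This is the kernel 1 / t^(1+2s) in the borderline case
  2 * s = m.\<close>

lemma log_integral_zero:
  fixes m :: nat
  assumes m: "1 \<le> m"
  shows "set_integrable lborel {0<..} (\<lambda>t::real. ln (1 - t ^ (2 * m)) / t ^ (m + 1))" (is "set_integrable _ _ ?f")
    and "(LINT t:{0::real<..}|lborel. ln (1 - t ^ (2 * m)) / t ^ (m + 1)) = 0"
proof -
  \<comment> \<open>At c the quantity \<bar>1 - t^(2m)\<bar> returns to 1, so the integrand changes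
    from negative to positive. The fundamental theorem is applied to integrands of one sign, whence
    the cuts at 1 and at c.\<close>
  define c where "c = (2::real) powr (1 / (2 * m))"
  have c2: "c ^ (2 * m) = 2"
    using m by (simp add: c_def powr_powr flip: powr_realpow)
  have c1: "1 < c" using m by (simp add: c_def)
  define F where "F = (\<lambda>t. log_primitive (t ^ m) / m)"
  have dF: "(F has_real_derivative ?f t) (at t)" if t: "0 < t" "t \<noteq> 1" for t
  proof -
    have tm: "0 < t ^ m" "t ^ m \<noteq> 1" using t m power_eq_imp_eq_base[of t m 1] by auto
    have "((\<lambda>t. log_primitive (t ^ m)) has_real_derivative
        ln (1 - (t ^ m)\<^sup>2) / (t ^ m)\<^sup>2 * (m * t ^ (m - 1))) (at t)"
      by (rule DERIV_chain2[where f = log_primitive and g = "\<lambda>t. t ^ m"])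
        (auto intro!: derivative_eq_intros log_primitive_deriv tm)
    from DERIV_cdivide[OF this, of m]
    have "(F has_real_derivative ln (1 - (t ^ m)\<^sup>2) / (t ^ m)\<^sup>2 * (m * t ^ (m - 1)) / m) (at t)"
      by (simp add: F_def)
    moreover have "ln (1 - (t ^ m)\<^sup>2) / (t ^ m)\<^sup>2 * (m * t ^ (m - 1)) / m = ?f t"
    proof -
      have "(m - 1) + (m + 1) = m * 2" using m by simp
      then have "(t ^ m)\<^sup>2 = t ^ (m - 1) * t ^ (m + 1)" by (metis power_add power_mult)
      moreover have "(t ^ m)\<^sup>2 = t ^ (2 * m)" by (simp flip: power_mult add: mult.commute)
      ultimately show ?thesis using t m by simp
    qed
    ultimately show ?thesis by simp
  qed
  have cf: "isCont ?f t" if t: "0 < t" "t \<noteq> 1" for t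
    using that m power_eq_imp_eq_base[of t "2 * m" 1] by (intro continuous_intros) auto
  have m0: "0 < m" using m by simp
  have lF: "(F \<longlongrightarrow> 0 / m) (at_right 0)" "(F \<longlongrightarrow> - 2 * ln 2 / m) (at_left 1)"
    "(F \<longlongrightarrow> - 2 * ln 2 / m) (at_right 1)" "(F \<longlongrightarrow> 0 / m) at_top"
  proof -
    have 1: "filterlim (\<lambda>t::real. t ^ m) (at_right 0) (at_right 0)" using m0 by real_asymp
    have 2: "filterlim (\<lambda>t::real. t ^ m) (at_left 1) (at_left 1)" using m0 by real_asymp
    have 3: "filterlim (\<lambda>t::real. t ^ m) (at_right 1) (at_right 1)" using m0 by real_asymp
    have 4: "filterlim (\<lambda>t::real. t ^ m) at_top at_top" using m0 by real_asymp
    show "(F \<longlongrightarrow> 0 / m) (at_right 0)" "(F \<longlongrightarrow> - 2 * ln 2 / m) (at_left 1)"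
      "(F \<longlongrightarrow> - 2 * ln 2 / m) (at_right 1)" "(F \<longlongrightarrow> 0 / m) at_top"
      unfolding F_def
      by (rule tendsto_divide[OF filterlim_compose[OF log_primitive_limits(1) 1] tendsto_const]
            tendsto_divide[OF filterlim_compose[OF log_primitive_limits(2) 2] tendsto_const]
            tendsto_divide[OF filterlim_compose[OF log_primitive_limits(3) 3] tendsto_const]
            tendsto_divide[OF filterlim_compose[OF log_primitive_limits(4) 4] tendsto_const]
          | use m0 in simp)+
  qed
  have lc: "(F \<longlongrightarrow> F c) (at c)"
    using DERIV_isCont[OF dF[of c]] c1 by (simp add: isCont_def)
  have pow_lt: "t ^ (2 * m) < 2" if "0 < t" "t < c" for t
    using power_strict_mono[of t c "2 * m"] that m c2 by simp
  have pow_gt: "2 \<le> t ^ (2 * m)" if "c < t" for t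
    using power_mono[of c t "2 * m"] that c1 c2 by simp
  have neg: "0 \<le> - ?f t" if t: "0 < t" "t < c" "t \<noteq> 1" for t
  proof -
    have "t ^ (2 * m) \<noteq> 1" using t m power_eq_imp_eq_base[of t "2 * m" 1] by auto
    then have "ln \<bar>1 - t ^ (2 * m)\<bar> \<le> 0"
      using pow_lt[OF t(1,2)] t by (intro ln_le_zero_iff[THEN iffD2]) (auto simp: abs_if)
    then show ?thesis using t unfolding ln_abs_eq by (simp add: divide_nonpos_pos)
  qed
  have dF': "((\<lambda>t. - F t) has_real_derivative - ?f t) (at t)" if "0 < t" "t \<noteq> 1" for t
    using DERIV_minus[OF dF[OF that]] .
  have piece: "set_integrable lborel {a<..<b} ?f" "(LINT t:{a<..<b}|lborel. ?f t) = B - A"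
    if ab: "0 \<le> a" "a < b" "b \<le> c" "b \<le> 1 \<or> 1 \<le> a"
      and A: "(F \<longlongrightarrow> A) (at_right a)" and B: "(F \<longlongrightarrow> B) (at_left b)" for a b A B
  proof -
    have d: "((\<lambda>t. - F t) has_real_derivative - ?f x) (at x)" if "a < x" "x < b" for x
      using that ab by (intro dF') auto
    have i: "isCont (\<lambda>t. - ?f t) x" if "a < x" "x < b" for x
      using that ab by (intro continuous_minus cf) auto
    have n: "0 \<le> - ?f x" if "a < x" "x < b" for x
      using that ab by (intro neg) auto
    note ftc = set_integral_FTC_nonneg_Ioo[OF ab(2) d i n tendsto_minus[OF A] tendsto_minus[OF B]]
    show fi: "set_integrable lborel {a<..<b} ?f"
      using set_integrable_mult_right[of "- 1", OF ftc(1)] by simp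
    show "(LINT t:{a<..<b}|lborel. ?f t) = B - A"
      using ftc(2) set_integral_uminus[OF fi] by simp
  qed
  have f1: "set_integrable lborel {0<..<1} ?f" "(LINT t:{0<..<1}|lborel. ?f t) = - 2 * ln 2 / m"
    using piece[OF _ _ _ _ lF(1,2)] c1 by simp_all
  have f2: "set_integrable lborel {1<..<c} ?f" "(LINT t:{1<..<c}|lborel. ?f t) = F c - (- 2 * ln 2 / m)"
    using piece[OF _ _ _ _ lF(3), of c "F c"] lc c1 by (simp_all add: filterlim_at_split)
  have pos: "0 \<le> ?f t" if "c < t" for t
  proof -
    have "0 \<le> ln (t ^ (2 * m) - 1)" using pow_gt[OF that] by simp
    then have "0 \<le> ln (1 - t ^ (2 * m))" using ln_minus[of "1 - t ^ (2 * m)"] by simp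
    then show ?thesis using that c1 by simp
  qed
  have 3: "set_integrable lborel {c<..} ?f" "(LINT t:{c<..}|lborel. ?f t) = 0 / m - F c"
  proof -
    have d: "(F has_real_derivative ?f x) (at x)" if "c < x" for x
      using that c1 by (intro dF) auto
    have i: "isCont ?f x" if "c < x" for x
      using that c1 by (intro cf) auto
    have r: "(F \<longlongrightarrow> F c) (at_right c)" using lc by (simp add: filterlim_at_split)
    note ftc = set_integral_FTC_nonneg_Ioi[OF d i pos r lF(4)]
    show "set_integrable lborel {c<..} ?f" "(LINT t:{c<..}|lborel. ?f t) = 0 / m - F c"
      using ftc by simp_all
  qed
  let ?S = "{0<..<1} \<union> ({1<..<c} \<union> {c<..})"
  have S23: "set_integrable lborel ({1<..<c} \<union> {c<..}) ?f"
    by (rule set_integrable_Un[OF f2(1) 3(1)]) auto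
  have S: "set_integrable lborel ?S ?f"
    by (rule set_integrable_Un[OF f1(1) S23]) auto
  have "(LINT t:?S|lborel. ?f t) = (LINT t:{0<..<1}|lborel. ?f t) + (LINT t:{1<..<c} \<union> {c<..}|lborel. ?f t)"
    by (rule set_integral_Un[OF _ f1(1) S23]) (use c1 in auto)
  also have "(LINT t:{1<..<c} \<union> {c<..}|lborel. ?f t) = (LINT t:{1<..<c}|lborel. ?f t) + (LINT t:{c<..}|lborel. ?f t)"
    by (rule set_integral_Un[OF _ f2(1) 3(1)]) auto
  finally have S0: "(LINT t:?S|lborel. ?f t) = 0"
    using f1(2) f2(2) 3(2) by simp
  have ae: "AE t in lborel. indicator ?S t *\<^sub>R ?f t = indicator {0<..} t *\<^sub>R ?f t"
    using AE_lborel_singleton[of 1] AE_lborel_singleton[of c]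
    by eventually_elim (use c1 in \<open>auto simp: indicator_def\<close>)
  have fm: "?f \<in> borel_measurable lborel" by measurable
  show "set_integrable lborel {0<..} ?f"
    using S ae unfolding set_integrable_def by (subst (asm) integrable_cong_AE) (auto intro!: fm)
  show "(LINT t:{0<..}|lborel. ?f t) = 0"
    using S0 ae unfolding set_lebesgue_integral_def by (subst (asm) integral_cong_AE) (auto intro!: fm)
qed

text \<open>Compared with the borderline kernel there is an extra weight t^e, increasing because e =
  m - 2 s > 0. The borderline integrand changes sign once, from negative to positive at c, and
  integrates to zero; subtracting c^e times it leaves the integral unchanged and makes the integrand
  nonnegative.\<close>

lemma log_moment_pos:
  fixes m :: nat and s :: real
  assumes m: "1 \<le> m" and s: "0 < s" "2 * s < m"
  shows "set_integrable lborel {0<..} (\<lambda>t::real. ln (1 - t ^ (2 * m)) / t powr (1 + 2 * s))" (is "set_integrable _ _ ?h")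
    and "0 < (LINT t:{0::real<..}|lborel. ln (1 - t ^ (2 * m)) / t powr (1 + 2 * s))"
proof -
  let ?f = "\<lambda>t::real. ln (1 - t ^ (2 * m)) / t ^ (m + 1)"
  define e where "e = m - 2 * s"
  have e: "0 < e" using s by (simp add: e_def)
  define c where "c = (2::real) powr (1 / (2 * m))"
  have c2: "c ^ (2 * m) = 2"
    using m by (simp add: c_def powr_powr flip: powr_realpow)
  have c1: "1 < c" using m by (simp add: c_def)
  have "c \<le> 2 powr 1" unfolding c_def using m by (intro powr_mono) auto
  then have c3: "c \<le> 2" by simp
  have hf: "?h t = ?f t * t powr e" if "0 < t" for t
  proof -
    have "t powr (1 + 2 * s) = t powr (real (m + 1) - e)" by (simp add: e_def)
    also have "\<dots> = t ^ (m + 1) / t powr e" unfolding powr_diff powr_realpow[OF that] ..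
    finally show ?thesis by simp
  qed
  have pow_lt: "t ^ (2 * m) < 2" if "0 < t" "t < c" for t
    using power_strict_mono[of t c "2 * m"] that m c2 by simp
  have pow_gt: "2 \<le> t ^ (2 * m)" if "c \<le> t" for t
    using power_mono[of c t "2 * m"] that c1 c2 by simp
  have neg: "?f t \<le> 0" if t: "0 < t" "t < c" for t
  proof -
    have "ln \<bar>1 - t ^ (2 * m)\<bar> \<le> 0"
    proof (cases "t ^ (2 * m) = 1")
      case False
      then show ?thesis
        using pow_lt[OF t] t by (intro ln_le_zero_iff[THEN iffD2]) (auto simp: abs_if)
    qed simp
    then show ?thesis using t unfolding ln_abs_eq by (simp add: divide_nonpos_pos)
  qed
  have lneq: "ln (1 - t ^ (2 * m)) = ln (t ^ (2 * m) - 1)" for t :: real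
    using ln_minus[of "1 - t ^ (2 * m)"] by simp
  have pos: "0 \<le> ?f t" if "c \<le> t" for t
    unfolding lneq using pow_gt[OF that] that c1 by simp
  have fint: "set_integrable lborel {0<..} ?f" by (rule log_integral_zero(1)[OF m])
  \<comment> \<open>Below c the weight t^e is at most c^e. Beyond c the logarithm is at most 2 m *
    ln t, hence at most 2 m * t^s / s, which leaves the integrable power t^(-1-s).\<close>
  define b where "b = (\<lambda>t. \<bar>c powr e * ?f t\<bar> + (2 * m / s) * (indicator {c..} t * t powr (- 1 - s)))"
  have tail: "set_integrable lborel {0<..} (\<lambda>t. (2 * m / s) * (indicator {c..} t * t powr (- 1 - s)))"
  proof -
    have "set_integrable lebesgue {c..} (\<lambda>t. t powr (- 1 - s))"
      by (rule set_integrable_powr_tail) (use c1 s in auto)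
    then have i: "integrable lborel (\<lambda>t. indicator {c..} t * t powr (- 1 - s))"
      unfolding set_integrable_def by (subst (asm) integrable_completion) auto
    show ?thesis
      unfolding set_integrable_def by (intro integrable_mult_indicator integrable_mult_right i) auto
  qed
  have b: "set_integrable lborel {0<..} b"
    unfolding b_def by (intro set_integral_add set_integrable_abs set_integrable_mult_right fint tail)
  show hint: "set_integrable lborel {0<..} ?h"
  proof (rule set_integrable_bound[OF b])
    show "set_borel_measurable lborel {0<..} ?h"
      unfolding set_borel_measurable_def by measurable
    have "norm (?h t) \<le> norm (b t)" if t: "0 < t" for t
    proof (cases "t < c")
      case True
      have "t powr e \<le> c powr e" using t True e by (intro powr_mono2) auto
      then have "\<bar>?f t\<bar> * t powr e \<le> \<bar>?f t\<bar> * c powr e" by (rule mult_left_mono) simp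
      then have "\<bar>?h t\<bar> \<le> \<bar>c powr e * ?f t\<bar>"
        unfolding hf[OF t] abs_mult by (simp only: abs_of_nonneg powr_ge_zero mult.commute[of "c powr e"])
      then show ?thesis using True by (simp add: b_def)
    next
      case False
      then have t1: "1 < t" using c1 by simp
      have g: "2 \<le> t ^ (2 * m)" using pow_gt False by simp
      have "ln (t ^ (2 * m) - 1) \<le> ln (t ^ (2 * m))" using g by (intro ln_mono) auto
      also have "\<dots> = 2 * m * ln t" by (simp add: ln_realpow)
      also have "\<dots> \<le> 2 * m * (t powr s / s)" using t1 s by (intro mult_left_mono ln_powr_bound) auto
      finally have "ln (t ^ (2 * m) - 1) / t powr (1 + 2 * s) \<le> 2 * m * (t powr s / s) / t powr (1 + 2 * s)"
        by (intro divide_right_mono) auto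
      also have "\<dots> = (2 * m / s) * t powr (- 1 - s)"
      proof -
        have "s - (1 + 2 * s) = - 1 - s" by simp
        from powr_diff[of t s "1 + 2 * s", unfolded this] show ?thesis by simp
      qed
      finally have 1: "?h t \<le> (2 * m / s) * t powr (- 1 - s)" unfolding lneq .
      have 2: "0 \<le> ?h t" unfolding lneq using g by simp
      have "b t = \<bar>c powr e * ?f t\<bar> + (2 * m / s) * t powr (- 1 - s)"
        using False by (simp add: b_def)
      then have "?h t \<le> b t" using 1 abs_ge_zero[of "c powr e * ?f t"] by linarith
      then show ?thesis using 2 unfolding real_norm_def by linarith
    qed
    then show "AE t in lborel. t \<in> {0<..} \<longrightarrow> norm (?h t) \<le> norm (b t)" by auto
  qed
  let ?d = "\<lambda>t. ?h t + (- (c powr e)) * ?f t"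
  have factor: "x * p + (- q) * x = x * (p - q)" for x p q :: real by (simp add: algebra_simps)
  have deq': "?d t = ?f t * (t powr e - c powr e)" if "0 < t" for t
    unfolding hf[OF that] by (rule factor)
  have dnn: "0 \<le> ?d t" if t: "0 < t" for t
  proof -
    have "?d t = ?f t * (t powr e - c powr e)" by (rule deq'[OF t])
    also have "0 \<le> \<dots>"
    proof (cases "t < c")
      case True
      then show ?thesis
        using neg[OF t True] t e by (intro mult_nonpos_nonpos) (auto intro!: powr_mono2)
    next
      case False
      then show ?thesis
        using pos[of t] c1 e by (intro mult_nonneg_nonneg) (auto intro!: powr_mono2)
    qed
    finally show ?thesis .
  qed
  have dint: "set_integrable lborel {0<..} ?d"
    by (intro set_integral_add set_integrable_mult_right hint fint)
  have deq: "(LINT t:{0<..}|lborel. ?d t) = (LINT t:{0<..}|lborel. ?h t)"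
    using set_integral_add(2)[OF hint set_integrable_mult_right[of "- (c powr e)", OF fint]]
    unfolding set_integral_mult_right log_integral_zero(2)[OF m] by simp
  have "(LINT t:{0<..}|lborel. ?d t) \<noteq> 0"
  proof
    assume 0: "(LINT t:{0<..}|lborel. ?d t) = 0"
    have "AE t in lborel. indicator {0<..} t *\<^sub>R ?d t = 0"
      using 0 dint dnn unfolding set_lebesgue_integral_def set_integrable_def
      by (subst (asm) integral_nonneg_eq_0_iff_AE) (auto simp: indicator_def)
    \<comment> \<open>Strict positivity on a set of positive measure is enough, and c is at most 2,
      so {2<..<3} lies beyond the sign change.\<close>
    moreover have "0 < ?d t" if t: "2 < t" for t
    proof -
      have "2 < t ^ (2 * m)" using power_strict_mono[of c t "2 * m"] t c1 c2 c3 m by simp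
      then have "0 < ?f t" unfolding lneq using t by simp
      moreover have "c powr e < t powr e" using t c1 c3 e by (intro powr_less_mono2) auto
      moreover have "?d t = ?f t * (t powr e - c powr e)" by (rule deq') (use t in simp)
      ultimately show ?thesis by (simp only: mult_pos_pos diff_gt_0_iff_gt)
    qed
    ultimately have "AE t in lborel. t \<notin> {2<..<3::real}"
      by (auto elim!: eventually_mono simp: indicator_def) (metis less_irrefl)
    then have "emeasure lborel {2<..<3::real} = 0" by (subst (asm) AE_iff_measurable[of "{2<..<3}"]) auto
    then show False by simp
  qed
  moreover have "0 \<le> (LINT t:{0<..}|lborel. ?d t)"
    using dnn unfolding set_lebesgue_integral_def by (intro integral_nonneg_AE) (auto simp: indicator_def)
  ultimately show "0 < (LINT t:{0<..}|lborel. ?h t)" unfolding deq by simp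
qed

section \<open>The critical exponent\<close>

text \<open>Difference quotients at 0 of the convex function sending g to a^(-g/2): they lie above
  the tangent slope and increase with g. The two facts give the lower and the upper half of a
  dominating function.\<close>

lemma power_quotient_bounds:
  fixes a g h :: real
  assumes a: "0 < a" and g: "0 < g" "g \<le> h"
  shows "- ln a / 2 \<le> (a powr (- g / 2) - 1) / g"
    and "(a powr (- g / 2) - 1) / g \<le> (a powr (- h / 2) - 1) / h"
proof -
  have "1 + (- g / 2 * ln a) \<le> a powr (- g / 2)"
    using a exp_ge_add_one_self[of "- g / 2 * ln a"] by (simp add: powr_def)
  then show "- ln a / 2 \<le> (a powr (- g / 2) - 1) / g" using g by (simp add: field_simps)
  have h: "0 < h" using g by simp
  have "a powr (- ((1 - g / h) * 0 + g / h * h) / 2) \<le> (1 - g / h) * a powr (- 0 / 2) + g / h * a powr (- h / 2)"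
    using a g h by (intro power_convex_in_exponent) auto
  then have "a powr (- g / 2) - 1 \<le> g / h * (a powr (- h / 2) - 1)"
    using h a by (simp add: algebra_simps)
  then have "(a powr (- g / 2) - 1) / g \<le> (g / h * (a powr (- h / 2) - 1)) / g"
    using g by (intro divide_right_mono) auto
  then show "(a powr (- g / 2) - 1) / g \<le> (a powr (- h / 2) - 1) / h" using g by simp
qed

lemma power_quotient_tendsto:
  fixes a :: real
  assumes a: "0 < a"
  shows "(\<lambda>n. (a powr (- (1 / (real n + 2)) / 2) - 1) / (1 / (real n + 2))) \<longlonglongrightarrow> - ln a / 2"
  using a by real_asymp

text \<open>Differentiating at g = 0 under the integral gives minus the logarithm of \<bar>1 -
  t^2\<bar> from the radial direction and minus that of 1 + t^2 from each orthogonal one. For one or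
  two directions the product collapses to \<bar>1 - t^(2m)\<bar>, the form whose moment is known to
  be positive, so some difference quotient must be negative.\<close>

lemma radial_coeff_neg:
  assumes m: "m = 1 \<or> m = 2" and s: "0 < s" "s < 1" "2 * s < m"
  obtains g where "0 < g" "g < 1" "radial_coeff s m g < 0"
proof -
  let ?T = "\<lambda>t. t powr (1 + 2 * s)"
  let ?L = "\<lambda>t::real. ln (1 - t ^ (2 * m))"
  define Q where "Q = (\<lambda>g t. power_diff g 1 t + (real m - 1) * power_diff g 0 t)"
  \<comment> \<open>A sequence tending to 0 from the right. Its terms stay at or below 1/2, so the
    quotient at g = 1/2, which is integrable, dominates from above.\<close>
  define G where "G = (\<lambda>n::nat. 1 / (real n + 2))"
  have G: "0 < G n" "G n \<le> 1 / 2" "G n < 1" for n by (auto simp: G_def)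
  have m1: "0 \<le> real m - 1" using m by auto
  have Qint: "set_integrable lebesgue {0<..} (\<lambda>t. Q g t / ?T t)"
    "(LINT t:{0<..}|lebesgue. Q g t / ?T t) = radial_coeff s m g" if g: "0 \<le> g" "g < 1" for g
  proof -
    have e: "(\<lambda>t. Q g t / ?T t) = (\<lambda>t. 1 * (power_diff g 1 t / ?T t) + (real m - 1) * (power_diff g 0 t / ?T t))"
      by (simp add: Q_def add_divide_distrib)
    have i: "set_integrable lebesgue {0<..} (\<lambda>t. power_diff g 1 t / ?T t)"
      "set_integrable lebesgue {0<..} (\<lambda>t. power_diff g 0 t / ?T t)"
      using set_integrable_power_diff[OF s(1,2) g] by auto
    show "set_integrable lebesgue {0<..} (\<lambda>t. Q g t / ?T t)"
      unfolding e by (rule set_integral_lincomb(1)[OF i])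
    show "(LINT t:{0<..}|lebesgue. Q g t / ?T t) = radial_coeff s m g"
      unfolding e set_integral_lincomb(2)[OF i] radial_coeff_def power_diff_integral_def by simp
  qed
  let ?p = "\<lambda>a g. (a powr (- g / 2) - 1) / g"
  let ?A = "\<lambda>t::real. 1 + t\<^sup>2 + 2 * t" and ?B = "\<lambda>t::real. 1 + t\<^sup>2 - 2 * t" and ?D = "\<lambda>t::real. 1 + t\<^sup>2"
  have Qp: "Q g t / g = ?p (?A t) g + ?p (?B t) g + (real m - 1) * (2 * ?p (?D t) g)" for g t
    by (simp add: Q_def power_diff_def add_divide_distrib diff_divide_distrib algebra_simps)
  have ABD: "0 < ?A t" "0 < ?B t" "0 < ?D t" if "0 < t" "t \<noteq> 1" for t
    using that square_plus_gt[of t] by (auto intro: add_pos_nonneg)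
  have L: "- ?L t = - ln (?A t) / 2 + - ln (?B t) / 2 + (real m - 1) * (2 * (- ln (?D t) / 2))"
    if t: "0 < t" "t \<noteq> 1" for t
  proof -
    have sq: "?A t = (1 + t)\<^sup>2" "?B t = (1 - t)\<^sup>2" by (simp_all add: power2_eq_square algebra_simps)
    have "ln (?A t) / 2 + ln (?B t) / 2 = ln (1 + t) + ln (1 - t)"
      unfolding sq ln_realpow by simp
    also have "\<dots> = ln (1 - t\<^sup>2)"
      using t ln_mult[of "1 + t" "1 - t"] by (simp add: power2_eq_square algebra_simps)
    finally have 1: "ln (?A t) / 2 + ln (?B t) / 2 = ln (1 - t\<^sup>2)" .
    have "ln (1 - t ^ 4) = ln (1 - t\<^sup>2) + ln (?D t)"
    proof -
      have "1 - t\<^sup>2 \<noteq> 0" using t by (simp add: power2_eq_1_iff)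
      moreover have "1 - t ^ 4 = (1 - t\<^sup>2) * ?D t" by (simp add: power2_eq_square algebra_simps power4_eq_xxxx)
      ultimately show ?thesis using ABD(3)[OF t] by (simp add: ln_mult)
    qed
    then show ?thesis using m 1 by auto
  qed
  have lower: "- ?L t \<le> Q g t / g" if "0 < t" "t \<noteq> 1" "0 < g" for t g
    unfolding Qp L[OF that(1,2)] using ABD[OF that(1,2)] m1 that(3)
    by (intro add_mono mult_left_mono power_quotient_bounds(1)[OF _ _ order_refl]) auto
  have upper: "Q g t / g \<le> Q (1/2) t / (1/2)" if "0 < t" "t \<noteq> 1" "0 < g" "g \<le> 1/2" for t g
    unfolding Qp using ABD[OF that(1,2)] m1 that(3,4)
    by (intro add_mono mult_left_mono power_quotient_bounds(2)) auto
  have limit: "(\<lambda>n. Q (G n) t / G n) \<longlonglongrightarrow> - ?L t" if "0 < t" "t \<noteq> 1" for t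
    unfolding Qp L[OF that] G_def using ABD[OF that]
    by (intro tendsto_add tendsto_mult tendsto_const power_quotient_tendsto)
  have m': "1 \<le> m" using m by auto
  have hm: "set_borel_measurable lborel {0<..} (\<lambda>t. ?L t / ?T t)"
    unfolding set_borel_measurable_def by measurable
  have Lint: "set_integrable lebesgue {0<..} (\<lambda>t. ?L t / ?T t)"
    "0 < (LINT t:{0<..}|lebesgue. ?L t / ?T t)"
    using log_moment_pos[OF m' s(1,3)] hm
    by (simp_all add: set_integrable_def set_lebesgue_integral_def set_borel_measurable_def
        integrable_completion integral_completion)
  have squeeze: "\<bar>q\<bar> \<le> \<bar>l\<bar> + \<bar>r\<bar> * 2" if "- l \<le> q" "q \<le> r / (1 / 2)" for l q r :: real
    using that by (simp add: abs_if)
  let ?I = "\<lambda>t::real. indicator {0<..} t :: real"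
  have conv: "(\<lambda>n. LINT t|lebesgue. ?I t *\<^sub>R (Q (G n) t / ?T t) / G n)
      \<longlonglongrightarrow> (LINT t|lebesgue. - (?I t *\<^sub>R (?L t / ?T t)))"
  proof (rule integral_dominated_convergence[where
        w = "\<lambda>t. norm (?I t *\<^sub>R (?L t / ?T t)) + norm (?I t *\<^sub>R (Q (1/2) t / ?T t)) * 2"])
    show "(\<lambda>t. - (?I t *\<^sub>R (?L t / ?T t))) \<in> borel_measurable lebesgue"
      using borel_measurable_integrable[OF Lint(1)[unfolded set_integrable_def]]
      by (rule borel_measurable_uminus)
    show "(\<lambda>t. ?I t *\<^sub>R (Q (G n) t / ?T t) / G n) \<in> borel_measurable lebesgue" for n
      using borel_measurable_integrable[OF Qint(1)[of "G n", unfolded set_integrable_def]] G[of n]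
      by (intro borel_measurable_divide) auto
    show "integrable lebesgue (\<lambda>t. norm (?I t *\<^sub>R (?L t / ?T t)) + norm (?I t *\<^sub>R (Q (1/2) t / ?T t)) * 2)"
      using Lint(1) Qint(1)[of "1/2"] unfolding set_integrable_def
      by (intro Bochner_Integration.integrable_add integrable_mult_left integrable_norm) auto
    show "AE t in lebesgue. (\<lambda>n. ?I t *\<^sub>R (Q (G n) t / ?T t) / G n) \<longlonglongrightarrow> - (?I t *\<^sub>R (?L t / ?T t))"
      using AE_lebesgue_neq[of 1]
    proof eventually_elim
      case (elim t)
      show ?case
      proof (cases "0 < t")
        case True
        have "(\<lambda>n. (Q (G n) t / G n) / ?T t) \<longlonglongrightarrow> - ?L t / ?T t"
          using True by (intro tendsto_divide limit elim tendsto_const) auto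
        then show ?thesis using True by (simp add: mult.commute)
      qed simp
    qed
    show "AE t in lebesgue. norm (?I t *\<^sub>R (Q (G n) t / ?T t) / G n)
        \<le> norm (?I t *\<^sub>R (?L t / ?T t)) + norm (?I t *\<^sub>R (Q (1/2) t / ?T t)) * 2" for n
      using AE_lebesgue_neq[of 1]
    proof eventually_elim
      case (elim t)
      show ?case
      proof (cases "0 < t")
        case True
        have "\<bar>Q (G n) t / G n\<bar> \<le> \<bar>?L t\<bar> + \<bar>Q (1/2) t\<bar> * 2"
          by (rule squeeze[OF lower[OF True elim G(1)] upper[OF True elim G(1,2)]])
        then have "\<bar>Q (G n) t / G n\<bar> / ?T t \<le> (\<bar>?L t\<bar> + \<bar>Q (1/2) t\<bar> * 2) / ?T t"
          by (rule divide_right_mono) simp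
        then show ?thesis using True by (simp add: add_divide_distrib abs_mult mult.commute)
      qed simp
    qed
  qed
  have eqn: "(LINT t|lebesgue. ?I t *\<^sub>R (Q (G n) t / ?T t) / G n) = radial_coeff s m (G n) / G n" for n
    using Qint(2)[of "G n"] G[of n] unfolding set_lebesgue_integral_def integral_divide_zero by auto
  show ?thesis
  proof (rule ccontr)
    assume no: "\<not> thesis"
    have "0 \<le> radial_coeff s m (G n) / G n" for n
      using that[of "G n"] no G[of n] by (intro divide_nonneg_pos) force+
    then have "0 \<le> (LINT t|lebesgue. - (?I t *\<^sub>R (?L t / ?T t)))"
      using conv unfolding eqn by (intro LIMSEQ_le_const) auto
    then show False using Lint(2) unfolding set_lebesgue_integral_def by simp
  qed
qed

text \<open>Along a direction orthogonal to x the power only decreases, so every further orthogonal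
  direction contributes a nonpositive amount. Negativity for two directions thus passes to all
  larger k.\<close>

lemma radial_coeff_antimono:
  assumes s: "0 < s" "s < 1" and g: "0 \<le> g" "g < 1" and "k \<le> l"
  shows "radial_coeff s l g \<le> radial_coeff s k g"
proof -
  have "power_diff_integral s g 0 \<le> (LINT t:{0::real<..}|lebesgue. 0)"
    unfolding power_diff_integral_def
    using set_integrable_power_diff[OF s g, of 0] power_diff_0_bounds(2)[of g] g
    by (intro set_integral_mono) (auto intro!: divide_nonpos_nonneg simp: set_integrable_def)
  then have "power_diff_integral s g 0 \<le> 0" by (simp add: set_lebesgue_integral_def)
  then have "(real l - 1) * power_diff_integral s g 0 \<le> (real k - 1) * power_diff_integral s g 0"
    using assms by (intro mult_right_mono_neg) auto
  then show ?thesis by (simp add: radial_coeff_def)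
qed

text \<open>Plain convexity gives uniqueness thanks to the negative value at a: a zero in (0, a] is
  impossible, since the coefficient is negative there, and the smaller of two zeros beyond a would
  lie strictly between a and the larger one, where convexity again forces a negative value.\<close>

lemma radial_coeff_root:
  assumes s: "0 < s" "s < 1" and k: "1 \<le> k" "k = 1 \<Longrightarrow> s < 1 / 2"
  shows "\<exists>!g. 0 < g \<and> g < 1 \<and> radial_coeff s k g = 0"
proof -
  let ?c = "radial_coeff s k"
  \<comment> \<open>The hypotheses on s say precisely that 2 * s < m: s < 1/2 for m = 1 and s < 1
    for m = 2.\<close>
  define m where "m = min k 2"
  have m: "m = 1 \<or> m = 2" "2 * s < m" "m \<le> k" using k s by (cases "k = 1"; auto simp: m_def min_def)+
  obtain a where a: "0 < a" "a < 1" "radial_coeff s m a < 0"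
    using radial_coeff_neg[OF m(1) s m(2)] by blast
  then have ca: "?c a < 0" using radial_coeff_antimono[OF s _ _ m(3), of a] by auto
  obtain b where b: "a < b" "b < 1" "0 < ?c b"
    using radial_coeff_pos_near_1[OF s k(1) a(2)] by blast
  have conv: "convex_on {0..<1} ?c" by (rule convex_on_radial_coeff[OF s k(1)])
  have "continuous_on {0<..<1} ?c"
    by (rule convex_on_continuous[OF open_greaterThanLessThan convex_on_subset[OF conv]]) auto
  then have "continuous_on {a..b} ?c" by (rule continuous_on_subset) (use a b in auto)
  then obtain g where g: "a \<le> g" "g \<le> b" "?c g = 0"
    using IVT'[of ?c a 0 b] ca b by auto
  have neg: "?c y < 0" if xyz: "0 \<le> x" "x < y" "y < z" "z < 1" and c: "?c x \<le> 0" "?c z \<le> 0" "?c x < 0 \<or> ?c z < 0"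
    for x y z
  proof -
    define t where "t = (y - x) / (z - x)"
    have t: "0 < t" "t < 1" using xyz by (auto simp: t_def)
    have "t * (z - x) = y - x" using xyz by (simp add: t_def)
    then have y: "y = (1 - t) * x + t * z" by (simp add: algebra_simps)
    have "?c y \<le> (1 - t) * ?c x + t * ?c z"
      using convex_onD[OF conv, of t x z] t xyz unfolding y by simp
    also have "\<dots> < 0"
      using c t by (smt (verit) mult_nonneg_nonpos mult_pos_neg)
    finally show ?thesis .
  qed
  have after: "a < y" if y: "0 < y" "y < 1" "?c y = 0" for y
    using neg[of 0 y a] radial_coeff_0[of s k] ca y a by (cases y a rule: linorder_cases) auto
  show ?thesis
  proof (rule ex1I[of _ g])
    show "0 < g \<and> g < 1 \<and> ?c g = 0" using g a b by auto
    fix y assume y: "0 < y \<and> y < 1 \<and> ?c y = 0"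
    have "a < y" "a < g" using after[of y] after[of g] y g a b by auto
    then show "y = g"
      using neg[of a y g] neg[of a g y] y g a b ca by (cases y g rule: linorder_cases) auto
  qed
qed

text \<open>The factor in front of \<open>radial_coeff\<close> is positive, so the condition at all
  nonzero x is one scalar equation in g, recovered from a single unit vector. Its unique solvability
  lets the definite description be unfolded.\<close>

lemma gamma_bar_pos:
  assumes s: "0 < s" "s < 1" and k: "1 \<le> k" "k \<le> DIM('a::euclidean_space)" "k = 1 \<Longrightarrow> s < 1 / 2"
    and C: "0 < C s"
  shows "0 < gamma_bar TYPE('a) C s k"
proof -
  obtain x0 :: 'a where x0: "norm x0 = 1" using vector_choose_size[of 1] by (metis zero_le_one)
  have "(0 < g \<and> g < 1 \<and> (\<forall>x::'a. x \<noteq> 0 \<longrightarrow> frac_plus C s k (\<lambda>y. norm y powr (- g)) x = 0))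
      \<longleftrightarrow> (0 < g \<and> g < 1 \<and> radial_coeff s k g = 0)" for g
  proof (cases "0 < g \<and> g < 1")
    case True
    then have e: "frac_plus C s k (\<lambda>y. norm y powr (- g)) x = C s * norm x powr (- g - 2 * s) * radial_coeff s k g"
      if "x \<noteq> 0" for x :: 'a
      using frac_plus_power[where C = C and s = s, OF s _ _ C k(1,2) that] by simp
    have "x0 \<noteq> 0" using x0 by auto
    then show ?thesis using True e e[of x0] x0 C by auto
  qed auto
  then have "\<exists>!g. 0 < g \<and> g < 1 \<and> (\<forall>x::'a. x \<noteq> 0 \<longrightarrow> frac_plus C s k (\<lambda>y. norm y powr (- g)) x = 0)"
    using radial_coeff_root[OF s k(1,3)] by simp
  from theI'[OF this] show ?thesis unfolding gamma_bar_def by blast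
qed

theorem theorem1p1:
  fixes u :: "(real ^ 'm) \<times> real \<Rightarrow> real"
    and N k :: nat and s p :: real and C :: "real \<Rightarrow> real"
  assumes "N = CARD('m) + 1"
    and "k \<in> {1..N}"
    and "0 < s" and "s < 1" and "k = 1 \<Longrightarrow> s < 1 / 2"
    and "normalizing_constant TYPE((real ^ 'm) \<times> real) C"
    and "dirichlet_supersolution (frac_plus C s k) s (\<lambda>x t. t powr p) u"
    and "\<And>x. 0 \<le> u x"
    and "0 < p" and "p < 1 + 2 * s / (gamma_bar TYPE((real ^ 'm) \<times> real) C s k + 1)"
  shows "\<forall>x\<in>half_space. u x = 0"
proof
  fix x :: "(real ^ 'm) \<times> real" assume x: "x \<in> half_space"
  have C: "0 < C s" using assms(3,4,6) by (simp add: normalizing_constant_def)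
  have k: "1 \<le> k" "k \<le> DIM((real ^ 'm) \<times> real)" using assms(1,2) by simp_all
  have super: "viscosity_supersolution (frac_plus C s k) s (\<lambda>x t. t powr p) u"
    using assms(7) by (simp add: dirichlet_supersolution_def)
  let ?g = "gamma_bar TYPE((real ^ 'm) \<times> real) C s k"
  have "0 < ?g" by (rule gamma_bar_pos[where s = s and C = C, OF assms(3,4) k assms(5) C])
  then have "2 * s / (?g + 1) \<le> 2 * s / 1" using assms(3) by (intro divide_left_mono) auto
  then have "p < 1 + 2 * s" using assms(10) by linarith
  then show "u x = 0"
    by (rule supersolution_subcritical_zero[where C = C and s = s, OF super assms(3,4) C assms(8) k assms(9) _ x])
qed

end
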